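(* Let $T$ be a closed $\lambda C$-term with $\vdash_M T : N^C\rightarrow\neg\neg N$. Then for every $n\geq 0$ there exist an integer $m\geq 0$ and a $\lambda C$-term $\tau_m\simeq_\beta\underline{m}$ such that for every classical integer $\theta_n$ of value $n$ there is a substitution $\sigma$ with $(T)\theta_n f\succ_C (f)\sigma(\tau_m)$, where $f$ is a variable.
   Context: $\lambda C$-terms are terms of the pure $\lambda$-calculus extended with a constant $C$; $(t)u$ denotes application, $(t)u_1\dots u_n$ iterated application. $\succ_C$ (head $C$-reduction) is the reflexive–transitive closure of $(\lambda xu)t\,t_1\dots t_n\to(u[t/x])t_1\dots t_n$ and $(C)t\,t_1\dots t_n\to(t)\lambda x(x)t_1\dots t_n$ ($x$ fresh). $\simeq_\beta$ is $\beta$-equivalence; $\underline{m}=\lambda x\lambda f(f)^m x$ is the Church integer. System $M2$ (second-order typing with classical variables): types are second-order formulas built from $\perp$ and atomic formulas $R(t_1,\dots,t_k)$ (first-order terms over a language with constant $0$ and unary function $s$, equations $u=v$ abbreviating $\forall Y(Y(u)\rightarrow Y(v))$, a fixed adequate set of equations $E$ with $a\approx b$ meaning $E$ entails $a=b$, adequate meaning $s(a)\not\approx0$ and $s(a)\approx s(b)\Rightarrow a\approx b$) using $\rightarrow,\forall x,\forall X$; $\neg A=A\rightarrow\perp$. Besides ordinary predicate variables there are classical predicate variables $X_C$. A type ends with $X$ if it is $X(\vec t)$, or $A\rightarrow B$ with $B$ ending with $X$, or $\forall vA$ with $A$ ending with $X$; a classical type is one ending with $\perp$ or with a classical variable. Rules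 of $M2$: axiom $\Gamma\vdash x_i:A_i$; $\rightarrow$-introduction and elimination; $\forall x$-introduction (if $x$ not free in $\Gamma$) and elimination (any term); $\forall X$-introduction (if $X$ not free in $\Gamma$) and elimination (any formula) for ordinary $X$; equational rule (from $t:A[u/x]$ and $u\approx v$ infer $t:A[v/x]$); $\Gamma\vdash C:\forall X_C\{\neg\neg X_C\rightarrow X_C\}$; $\forall X_C$-introduction (if $X_C$ not free in $\Gamma$); and $\forall X_C$-elimination instantiating $X_C$ only by classical types. System $M$ is the subsystem of $M2$ with only propositional (arity $0$) variables and constants, no first-order part and no equations; its rules are the axiom, $\rightarrow$-introduction/elimination, $\forall X$ and $\forall X_C$ introduction/elimination (the latter with classical types only) and the axiom for $C$. In $M$: $N=\forall X\{X,(X\rightarrow X)\rightarrow X\}$ and $N^C=\forall X_C\{X_C,(X_C\rightarrow X_C)\rightarrow X_C\}$. $N^C[x]=\forall X_C\{X_C(0),\forall y(X_C(y)\rightarrow X_C(sy))\rightarrow X_C(x)\}$; a classical integer of value $n$ is a closed $\lambda C$-term $\theta_n$ with $\vdash_{M2}\theta_n:N^C[s^n(0)]$. *)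

theory Defs
  imports Main
begin

section \<open>\<open>\<lambda>C\<close>-terms\<close>

text \<open>Terms are in de Bruijn notation: \<open>Var i\<close> is bound by the \<open>i\<close>-th enclosing \<open>Lam\<close>, or,
  if there are \<open>d \<le> i\<close> enclosing abstractions, is the free variable number \<open>i - d\<close>.\<close>

datatype trm = Var nat | App trm trm | Lam trm | Cst

primrec fv :: "trm \<Rightarrow> nat set" where
  "fv (Var i) = {i}"
| "fv (App t u) = fv t \<union> fv u"
| "fv (Lam t) = {i. Suc i \<in> fv t}"
| "fv Cst = {}"

definition closed_trm :: "trm \<Rightarrow> bool" where
  "closed_trm t \<longleftrightarrow> fv t = {}"

primrec rename :: "(nat \<Rightarrow> nat) \<Rightarrow> trm \<Rightarrow> trm" where
  "rename r (Var i) = Var (r i)"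
| "rename r (App t u) = App (rename r t) (rename r u)"
| "rename r (Lam t) = Lam (rename (\<lambda>i. case i of 0 \<Rightarrow> 0 | Suc j \<Rightarrow> Suc (r j)) t)"
| "rename r Cst = Cst"

abbreviation lift_trm :: "trm \<Rightarrow> trm" where
  "lift_trm \<equiv> rename Suc"

text \<open>Capture-avoiding simultaneous substitution of \<open>\<sigma> i\<close> for every free variable \<open>i\<close>.\<close>

primrec subst :: "(nat \<Rightarrow> trm) \<Rightarrow> trm \<Rightarrow> trm" where
  "subst \<sigma> (Var i) = \<sigma> i"
| "subst \<sigma> (App t u) = App (subst \<sigma> t) (subst \<sigma> u)"
| "subst \<sigma> (Lam t) = Lam (subst (\<lambda>i. case i of 0 \<Rightarrow> Var 0 | Suc j \<Rightarrow> lift_trm (\<sigma> j)) t)"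
| "subst \<sigma> Cst = Cst"

text \<open>\<open>inst u t\<close> is \<open>u[t/x]\<close> where \<open>u\<close> is the body of \<open>\<lambda>x u\<close>: index \<open>0\<close> is replaced by \<open>t\<close>
  and the other free indices drop by one.\<close>

definition inst :: "trm \<Rightarrow> trm \<Rightarrow> trm" where
  "inst u t = subst (\<lambda>i. case i of 0 \<Rightarrow> t | Suc j \<Rightarrow> Var j) u"

inductive beta :: "trm \<Rightarrow> trm \<Rightarrow> bool" where
  beta_redex: "beta (App (Lam u) t) (inst u t)"
| beta_appL: "beta t t' \<Longrightarrow> beta (App t u) (App t' u)"
| beta_appR: "beta u u' \<Longrightarrow> beta (App t u) (App t u')"
| beta_lam: "beta t t' \<Longrightarrow> beta (Lam t) (Lam t')"

definition beta_equiv :: "trm \<Rightarrow> trm \<Rightarrow> bool" (infix "\<simeq>\<beta>" 50) where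
  "t \<simeq>\<beta> u \<longleftrightarrow> equivclp beta t u"

text \<open>Iterated application \<open>(t)u\<^sub>1\<dots>u\<^sub>n\<close>.\<close>

definition apps :: "trm \<Rightarrow> trm list \<Rightarrow> trm" where
  "apps t us = foldl App t us"

inductive head_step :: "trm \<Rightarrow> trm \<Rightarrow> bool" where
  head_beta: "head_step (apps (App (Lam u) t) ts) (apps (inst u t) ts)"
| head_C: "head_step (apps (App Cst t) ts) (App t (Lam (apps (Var 0) (map lift_trm ts))))"

definition head_red :: "trm \<Rightarrow> trm \<Rightarrow> bool" (infix "\<succ>C" 50) where
  "t \<succ>C u \<longleftrightarrow> head_step\<^sup>*\<^sup>* t u"

text \<open>The Church integer \<open>\<lambda>x\<lambda>f(f)\<^sup>m x\<close>; note that the base point is abstracted first.\<close>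

definition church :: "nat \<Rightarrow> trm" where
  "church m = Lam (Lam ((App (Var 0) ^^ m) (Var 1)))"

section \<open>First-order terms and equations\<close>

text \<open>The constant \<open>0\<close> and the unary symbol \<open>s\<close> are constructors; the language may have further
  function symbols, and predicate constants. The symbols of the language are those of the type
  for which an arity is given, so that there may be none.\<close>

record ('f, 'p) language =
  fun_arity :: "'f \<rightharpoonup> nat"
  pred_arity :: "'p \<rightharpoonup> nat"

datatype 'f tm = FVar nat | Zero | Succ "'f tm" | Fn 'f "'f tm list"

fun wf_tm :: "('f, 'p) language \<Rightarrow> 'f tm \<Rightarrow> bool" where
  "wf_tm L (FVar i) \<longleftrightarrow> True"
| "wf_tm L Zero \<longleftrightarrow> True"
| "wf_tm L (Succ t) \<longleftrightarrow> wf_tm L t"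
| "wf_tm L (Fn g ts) \<longleftrightarrow> fun_arity L g = Some (length ts) \<and> (\<forall>t\<in>set ts. wf_tm L t)"

primrec tsubst :: "(nat \<Rightarrow> 'f tm) \<Rightarrow> 'f tm \<Rightarrow> 'f tm" where
  "tsubst \<sigma> (FVar i) = \<sigma> i"
| "tsubst \<sigma> Zero = Zero"
| "tsubst \<sigma> (Succ t) = Succ (tsubst \<sigma> t)"
| "tsubst \<sigma> (Fn g ts) = Fn g (map (tsubst \<sigma>) ts)"

definition equations_over :: "('f, 'p) language \<Rightarrow> ('f tm \<times> 'f tm) set \<Rightarrow> bool" where
  "equations_over L E \<longleftrightarrow> (\<forall>(u, v)\<in>E. wf_tm L u \<and> wf_tm L v)"

text \<open>\<open>eq_entails L E a b\<close> is \<open>a \<approx> b\<close>, i.e. \<open>a = b\<close> follows from the equations in \<open>E\<close>, whose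
  variables are understood universally.\<close>

inductive eq_entails :: "('f, 'p) language \<Rightarrow> ('f tm \<times> 'f tm) set \<Rightarrow> 'f tm \<Rightarrow> 'f tm \<Rightarrow> bool"
  for L :: "('f, 'p) language" and E :: "('f tm \<times> 'f tm) set" where
  eq_ax: "(u, v) \<in> E \<Longrightarrow> \<forall>i. wf_tm L (\<sigma> i) \<Longrightarrow> eq_entails L E (tsubst \<sigma> u) (tsubst \<sigma> v)"
| eq_refl: "wf_tm L a \<Longrightarrow> eq_entails L E a a"
| eq_sym: "eq_entails L E a b \<Longrightarrow> eq_entails L E b a"
| eq_trans: "eq_entails L E a b \<Longrightarrow> eq_entails L E b c \<Longrightarrow> eq_entails L E a c"
| eq_Succ: "eq_entails L E a b \<Longrightarrow> eq_entails L E (Succ a) (Succ b)"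
| eq_Fn: "fun_arity L g = Some (length as) \<Longrightarrow> list_all2 (eq_entails L E) as bs
    \<Longrightarrow> eq_entails L E (Fn g as) (Fn g bs)"

definition adequate :: "('f, 'p) language \<Rightarrow> ('f tm \<times> 'f tm) set \<Rightarrow> bool" where
  "adequate L E \<longleftrightarrow>
     (\<forall>a. wf_tm L a \<longrightarrow> \<not> eq_entails L E (Succ a) Zero) \<and>
     (\<forall>a b. wf_tm L a \<longrightarrow> wf_tm L b \<longrightarrow> eq_entails L E (Succ a) (Succ b) \<longrightarrow> eq_entails L E a b)"

section \<open>Second-order formulas\<close>

text \<open>\<open>Ord\<close> marks the ordinary predicate variables \<open>X\<close>, \<open>Cls\<close> the classical ones \<open>X\<^sub>C\<close>.\<close>

datatype kind = Ord | Cls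

text \<open>De Bruijn notation again. First-order variables and, for every kind \<open>\<kappa>\<close> and every arity \<open>k\<close>,
  the \<open>k\<close>-ary predicate variables of kind \<open>\<kappa>\<close> have indices of their own: \<open>PVar \<kappa> i ts\<close> is an
  occurrence of the variable with index \<open>i\<close> among those of kind \<open>\<kappa>\<close> and arity \<open>length ts\<close>, and
  \<open>All2 \<kappa> k A\<close> binds index \<open>0\<close> of kind \<open>\<kappa>\<close> and arity \<open>k\<close> only, leaving the indices of all other
  sorts of variables unchanged.\<close>

datatype ('f, 'p) fm =
    Bot
  | PVar kind nat "'f tm list"
  | PConst 'p "'f tm list"
  | Imp "('f, 'p) fm" "('f, 'p) fm"  (infixr "\<^bold>\<rightarrow>" 60)
  | All1 "('f, 'p) fm"
  | All2 kind nat "('f, 'p) fm"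

abbreviation Neg :: "('f, 'p) fm \<Rightarrow> ('f, 'p) fm" where
  "Neg A \<equiv> A \<^bold>\<rightarrow> Bot"

primrec wf_fm :: "('f, 'p) language \<Rightarrow> ('f, 'p) fm \<Rightarrow> bool" where
  "wf_fm L Bot \<longleftrightarrow> True"
| "wf_fm L (PVar \<kappa> i ts) \<longleftrightarrow> (\<forall>t\<in>set ts. wf_tm L t)"
| "wf_fm L (PConst p ts) \<longleftrightarrow> pred_arity L p = Some (length ts) \<and> (\<forall>t\<in>set ts. wf_tm L t)"
| "wf_fm L (A \<^bold>\<rightarrow> B) \<longleftrightarrow> wf_fm L A \<and> wf_fm L B"
| "wf_fm L (All1 A) \<longleftrightarrow> wf_fm L A"
| "wf_fm L (All2 \<kappa> k A) \<longleftrightarrow> wf_fm L A"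

primrec fsubst :: "(nat \<Rightarrow> 'f tm) \<Rightarrow> ('f, 'p) fm \<Rightarrow> ('f, 'p) fm" where
  "fsubst \<sigma> Bot = Bot"
| "fsubst \<sigma> (PVar \<kappa> i ts) = PVar \<kappa> i (map (tsubst \<sigma>) ts)"
| "fsubst \<sigma> (PConst p ts) = PConst p (map (tsubst \<sigma>) ts)"
| "fsubst \<sigma> (A \<^bold>\<rightarrow> B) = fsubst \<sigma> A \<^bold>\<rightarrow> fsubst \<sigma> B"
| "fsubst \<sigma> (All1 A) =
     All1 (fsubst (\<lambda>i. case i of 0 \<Rightarrow> FVar 0 | Suc j \<Rightarrow> tsubst (\<lambda>n. FVar (Suc n)) (\<sigma> j)) A)"
| "fsubst \<sigma> (All2 \<kappa> k A) = All2 \<kappa> k (fsubst \<sigma> A)"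

text \<open>\<open>finst A u\<close> is \<open>A[u/x]\<close> where \<open>A\<close> is the body of \<open>\<forall>xA\<close>.\<close>

definition finst :: "('f, 'p) fm \<Rightarrow> 'f tm \<Rightarrow> ('f, 'p) fm" where
  "finst A u = fsubst (\<lambda>i. case i of 0 \<Rightarrow> u | Suc j \<Rightarrow> FVar j) A"

text \<open>\<open>flift c\<close> makes room for one more first-order variable, at index \<open>c\<close>;
  \<open>plift \<kappa> k c\<close> does the same for predicate variables of kind \<open>\<kappa>\<close> and arity \<open>k\<close>.\<close>

definition flift :: "nat \<Rightarrow> ('f, 'p) fm \<Rightarrow> ('f, 'p) fm" where
  "flift c = fsubst (\<lambda>i. FVar (if i < c then i else Suc i))"

primrec plift :: "kind \<Rightarrow> nat \<Rightarrow> nat \<Rightarrow> ('f, 'p) fm \<Rightarrow> ('f, 'p) fm" where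
  "plift \<kappa> k c Bot = Bot"
| "plift \<kappa> k c (PVar \<kappa>' i ts) =
     PVar \<kappa>' (if \<kappa>' = \<kappa> \<and> length ts = k \<and> c \<le> i then Suc i else i) ts"
| "plift \<kappa> k c (PConst p ts) = PConst p ts"
| "plift \<kappa> k c (A \<^bold>\<rightarrow> B) = plift \<kappa> k c A \<^bold>\<rightarrow> plift \<kappa> k c B"
| "plift \<kappa> k c (All1 A) = All1 (plift \<kappa> k c A)"
| "plift \<kappa> k c (All2 \<kappa>' k' A) =
     All2 \<kappa>' k' (plift \<kappa> k (if \<kappa>' = \<kappa> \<and> k' = k then Suc c else c) A)"

text \<open>Second-order substitution \<open>A[G/X(x\<^sub>1,\<dots>,x\<^sub>k)]\<close> for the variable \<open>X\<close> of kind \<open>\<kappa>\<close>, arity \<open>k\<close> and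
  index \<open>i\<close>; higher indices of that kind and arity drop by one. In \<open>G\<close> the first-order indices
  \<open>0, \<dots>, k - 1\<close> are the parameters \<open>x\<^sub>1, \<dots>, x\<^sub>k\<close>, and index \<open>k + j\<close> is the first-order variable
  with index \<open>j\<close> in \<open>A\<close>.\<close>

definition param_inst :: "('f, 'p) fm \<Rightarrow> 'f tm list \<Rightarrow> ('f, 'p) fm" where
  "param_inst G ts = fsubst (\<lambda>j. if j < length ts then ts ! j else FVar (j - length ts)) G"

primrec psubst :: "kind \<Rightarrow> nat \<Rightarrow> nat \<Rightarrow> ('f, 'p) fm \<Rightarrow> ('f, 'p) fm \<Rightarrow> ('f, 'p) fm" where
  "psubst \<kappa> k i G Bot = Bot"
| "psubst \<kappa> k i G (PVar \<kappa>' j ts) =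
     (if \<kappa>' = \<kappa> \<and> length ts = k
      then if j < i then PVar \<kappa>' j ts else if j = i then param_inst G ts else PVar \<kappa>' (j - 1) ts
      else PVar \<kappa>' j ts)"
| "psubst \<kappa> k i G (PConst p ts) = PConst p ts"
| "psubst \<kappa> k i G (A \<^bold>\<rightarrow> B) = psubst \<kappa> k i G A \<^bold>\<rightarrow> psubst \<kappa> k i G B"
| "psubst \<kappa> k i G (All1 A) = All1 (psubst \<kappa> k i (flift k G) A)"
| "psubst \<kappa> k i G (All2 \<kappa>' k' A) =
     All2 \<kappa>' k' (psubst \<kappa> k (if \<kappa>' = \<kappa> \<and> k' = k then Suc i else i) (plift \<kappa>' k' 0 G) A)"

text \<open>Types ending with \<open>\<bottom>\<close> or with a classical variable. As in the usual definition of ``ends with'',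
  the final variable may be bound in the type.\<close>

primrec classical :: "('f, 'p) fm \<Rightarrow> bool" where
  "classical Bot \<longleftrightarrow> True"
| "classical (PVar \<kappa> i ts) \<longleftrightarrow> \<kappa> = Cls"
| "classical (PConst p ts) \<longleftrightarrow> False"
| "classical (A \<^bold>\<rightarrow> B) \<longleftrightarrow> classical B"
| "classical (All1 A) \<longleftrightarrow> classical A"
| "classical (All2 \<kappa> k A) \<longleftrightarrow> classical A"

text \<open>The type \<open>\<forall>X\<^sub>C{\<not>\<not>X\<^sub>C \<rightarrow> X\<^sub>C}\<close> of the constant \<open>C\<close>.\<close>

definition C_type :: "('f, 'p) fm" where
  "C_type = All2 Cls 0 (Neg (Neg (PVar Cls 0 [])) \<^bold>\<rightarrow> PVar Cls 0 [])"

section \<open>The system M2\<close>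

text \<open>The \<open>i\<close>-th type in a context is that of the term variable \<open>i\<close>. The side conditions
  ``not free in \<open>\<Gamma>\<close>'' are expressed by lifting the context in the premise.\<close>

inductive typ_M2 ::
  "('f, 'p) language \<Rightarrow> ('f tm \<times> 'f tm) set \<Rightarrow> ('f, 'p) fm list \<Rightarrow> trm \<Rightarrow> ('f, 'p) fm \<Rightarrow> bool"
  for L :: "('f, 'p) language" and E :: "('f tm \<times> 'f tm) set" where
  M2_ax: "\<forall>A\<in>set \<Gamma>. wf_fm L A \<Longrightarrow> i < length \<Gamma> \<Longrightarrow> typ_M2 L E \<Gamma> (Var i) (\<Gamma> ! i)"
| M2_C: "\<forall>A\<in>set \<Gamma>. wf_fm L A \<Longrightarrow> typ_M2 L E \<Gamma> Cst C_type"
| M2_impI: "typ_M2 L E (A # \<Gamma>) t B \<Longrightarrow> typ_M2 L E \<Gamma> (Lam t) (A \<^bold>\<rightarrow> B)"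
| M2_impE: "typ_M2 L E \<Gamma> t (A \<^bold>\<rightarrow> B) \<Longrightarrow> typ_M2 L E \<Gamma> u A \<Longrightarrow> typ_M2 L E \<Gamma> (App t u) B"
| M2_all1I: "typ_M2 L E (map (flift 0) \<Gamma>) t A \<Longrightarrow> typ_M2 L E \<Gamma> t (All1 A)"
| M2_all1E: "typ_M2 L E \<Gamma> t (All1 A) \<Longrightarrow> wf_tm L u \<Longrightarrow> typ_M2 L E \<Gamma> t (finst A u)"
| M2_all2I: "typ_M2 L E (map (plift \<kappa> k 0) \<Gamma>) t A \<Longrightarrow> typ_M2 L E \<Gamma> t (All2 \<kappa> k A)"
| M2_all2E_Ord: "typ_M2 L E \<Gamma> t (All2 Ord k A) \<Longrightarrow> wf_fm L G
    \<Longrightarrow> typ_M2 L E \<Gamma> t (psubst Ord k 0 G A)"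
| M2_all2E_Cls: "typ_M2 L E \<Gamma> t (All2 Cls k A) \<Longrightarrow> wf_fm L G \<Longrightarrow> classical G
    \<Longrightarrow> typ_M2 L E \<Gamma> t (psubst Cls k 0 G A)"
| M2_eq: "typ_M2 L E \<Gamma> t (finst A u) \<Longrightarrow> eq_entails L E u v \<Longrightarrow> typ_M2 L E \<Gamma> t (finst A v)"

definition NC_at :: "'f tm \<Rightarrow> ('f, 'p) fm" where
  "NC_at u = All2 Cls 1
     (PVar Cls 0 [Zero]
      \<^bold>\<rightarrow> All1 (PVar Cls 0 [FVar 0] \<^bold>\<rightarrow> PVar Cls 0 [Succ (FVar 0)])
      \<^bold>\<rightarrow> PVar Cls 0 [u])"

definition classical_integer ::
  "('f, 'p) language \<Rightarrow> ('f tm \<times> 'f tm) set \<Rightarrow> nat \<Rightarrow> trm \<Rightarrow> bool" where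
  "classical_integer L E n \<theta> \<longleftrightarrow> closed_trm \<theta> \<and> typ_M2 L E [] \<theta> (NC_at ((Succ ^^ n) Zero))"

section \<open>The system M\<close>

primrec propositional :: "('f, 'p) language \<Rightarrow> ('f, 'p) fm \<Rightarrow> bool" where
  "propositional L Bot \<longleftrightarrow> True"
| "propositional L (PVar \<kappa> i ts) \<longleftrightarrow> ts = []"
| "propositional L (PConst p ts) \<longleftrightarrow> pred_arity L p = Some 0 \<and> ts = []"
| "propositional L (A \<^bold>\<rightarrow> B) \<longleftrightarrow> propositional L A \<and> propositional L B"
| "propositional L (All1 A) \<longleftrightarrow> False"
| "propositional L (All2 \<kappa> k A) \<longleftrightarrow> k = 0 \<and> propositional L A"

inductive typ_M :: "('f, 'p) language \<Rightarrow> ('f, 'p) fm list \<Rightarrow> trm \<Rightarrow> ('f, 'p) fm \<Rightarrow> bool"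
  for L :: "('f, 'p) language" where
  M_ax: "\<forall>A\<in>set \<Gamma>. propositional L A \<Longrightarrow> i < length \<Gamma> \<Longrightarrow> typ_M L \<Gamma> (Var i) (\<Gamma> ! i)"
| M_C: "\<forall>A\<in>set \<Gamma>. propositional L A \<Longrightarrow> typ_M L \<Gamma> Cst C_type"
| M_impI: "typ_M L (A # \<Gamma>) t B \<Longrightarrow> typ_M L \<Gamma> (Lam t) (A \<^bold>\<rightarrow> B)"
| M_impE: "typ_M L \<Gamma> t (A \<^bold>\<rightarrow> B) \<Longrightarrow> typ_M L \<Gamma> u A \<Longrightarrow> typ_M L \<Gamma> (App t u) B"
| M_all2I: "typ_M L (map (plift \<kappa> 0 0) \<Gamma>) t A \<Longrightarrow> typ_M L \<Gamma> t (All2 \<kappa> 0 A)"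
| M_all2E_Ord: "typ_M L \<Gamma> t (All2 Ord 0 A) \<Longrightarrow> propositional L G
    \<Longrightarrow> typ_M L \<Gamma> t (psubst Ord 0 0 G A)"
| M_all2E_Cls: "typ_M L \<Gamma> t (All2 Cls 0 A) \<Longrightarrow> propositional L G \<Longrightarrow> classical G
    \<Longrightarrow> typ_M L \<Gamma> t (psubst Cls 0 0 G A)"

definition N_type :: "('f, 'p) fm" where
  "N_type = All2 Ord 0
     (PVar Ord 0 [] \<^bold>\<rightarrow> (PVar Ord 0 [] \<^bold>\<rightarrow> PVar Ord 0 []) \<^bold>\<rightarrow> PVar Ord 0 [])"

definition NC_type :: "('f, 'p) fm" where
  "NC_type = All2 Cls 0
     (PVar Cls 0 [] \<^bold>\<rightarrow> (PVar Cls 0 [] \<^bold>\<rightarrow> PVar Cls 0 []) \<^bold>\<rightarrow> PVar Cls 0 [])"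

end

theory Submission
  imports Defs
begin

text \<open>Run \<open>(T)\<nu> f\<close> on an unknown \<open>\<nu>\<close> of value \<open>n\<close>: when \<open>\<nu> a b\<close> reaches head position it becomes a
  new unknown of value \<open>n\<close>, and an unknown of value \<open>k\<close> built from \<open>a, b\<close> that reaches head position
  becomes \<open>(b)z\<close> with \<open>z\<close> unknown of value \<open>k - 1\<close>, or \<open>a\<close> if \<open>k = 0\<close>. A realizability model whose pole
  is this run shows that it ends in \<open>(f)\<tau>\<close>, and that \<open>\<tau>\<close> is equivalent to a Church integer, because
  the ordinary variable of \<open>N\<close> may denote the set of the terms that represent \<open>(g)\<^sup>m x\<close>. The run does not
  depend on \<open>\<theta>\<^sub>n\<close>. In a second model, over the first-order terms modulo the equations, with the terms
  reaching \<open>(f)\<sigma>(\<tau>)\<close> for some \<open>\<sigma>\<close> as pole, \<open>\<theta>\<^sub>n a b\<close> belongs to every classical set obtained from \<open>a\<close>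
  by \<open>n\<close> applications of \<open>b\<close>. By induction backwards along the run, this lets \<open>\<theta>\<^sub>n\<close> take the
  place of \<open>\<nu>\<close>.\<close>

section \<open>Substitution and head reduction\<close>

lemma finite_fv: "finite (fv t)"
proof (induction t)
  case (Lam t)
  have "{i. Suc i \<in> fv t} = Suc -` fv t" by auto
  then show ?case using Lam by (simp add: finite_vimageI)
qed auto

lemma rename_cong: "(\<And>i. i \<in> fv t \<Longrightarrow> r i = r' i) \<Longrightarrow> rename r t = rename r' t"
proof (induction t arbitrary: r r')
  case (Lam t)
  show ?case by simp (rule Lam.IH, auto split: nat.split intro: Lam.prems)
next
  case (App t u)
  show ?case using App.IH[of r r'] App.prems by auto
qed auto

lemma subst_cong: "(\<And>i. i \<in> fv t \<Longrightarrow> \<sigma> i = \<sigma>' i) \<Longrightarrow> subst \<sigma> t = subst \<sigma>' t"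
proof (induction t arbitrary: \<sigma> \<sigma>')
  case (Lam t)
  show ?case by simp (rule Lam.IH, auto split: nat.split simp: Lam.prems)
next
  case (App t u)
  show ?case using App.IH[of \<sigma> \<sigma>'] App.prems by auto
qed auto

lemma rename_rename: "rename r (rename r' t) = rename (\<lambda>i. r (r' i)) t"
  by (induction t arbitrary: r r') (auto intro!: rename_cong split: nat.split)

lemma subst_rename: "subst \<sigma> (rename r t) = subst (\<lambda>i. \<sigma> (r i)) t"
  by (induction t arbitrary: r \<sigma>) (auto intro!: subst_cong split: nat.split)

lemma rename_subst: "rename r (subst \<sigma> t) = subst (\<lambda>i. rename r (\<sigma> i)) t"
  by (induction t arbitrary: r \<sigma>)
    (auto intro!: subst_cong split: nat.split simp: rename_rename)

lemma subst_subst: "subst \<sigma> (subst \<sigma>' t) = subst (\<lambda>i. subst \<sigma> (\<sigma>' i)) t"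
  by (induction t arbitrary: \<sigma> \<sigma>')
    (auto intro!: subst_cong split: nat.split simp: subst_rename rename_subst)

lemma rename_eq_subst: "rename r t = subst (\<lambda>i. Var (r i)) t"
  by (induction t arbitrary: r) (auto intro!: subst_cong split: nat.split)

lemma subst_Var: "subst Var t = t"
proof (induction t)
  case (Lam t)
  have "case_nat (Var 0) (\<lambda>j. lift_trm (Var j)) = Var" by (auto split: nat.split)
  with Lam show ?case by (simp only: subst.simps)
qed auto

lemma subst_closed: "closed_trm t \<Longrightarrow> subst \<sigma> t = t"
  using subst_cong[of t \<sigma> Var] by (simp add: closed_trm_def subst_Var)

lemma subst_inst:
  "subst \<sigma> (inst u t) =
     inst (subst (\<lambda>i. case i of 0 \<Rightarrow> Var 0 | Suc j \<Rightarrow> lift_trm (\<sigma> j)) u) (subst \<sigma> t)"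
  by (auto simp: inst_def subst_subst subst_rename subst_Var intro!: subst_cong split: nat.split)

lemma inst_subst_lift:
  "inst (subst (\<lambda>i. case i of 0 \<Rightarrow> Var 0 | Suc j \<Rightarrow> lift_trm (\<sigma> j)) u) t = subst (case_nat t \<sigma>) u"
  by (auto simp: inst_def subst_subst subst_rename subst_Var intro!: subst_cong split: nat.split)

lemma rename_inst:
  "rename r (inst u t) =
     inst (rename (\<lambda>i. case i of 0 \<Rightarrow> 0 | Suc j \<Rightarrow> Suc (r j)) u) (rename r t)"
  by (auto simp: inst_def rename_subst subst_rename intro!: subst_cong split: nat.split)

lemma rename_inst_Var: "rename r (inst u (Var x)) = rename (case_nat (r x) r) u"
  by (auto simp: inst_def rename_subst rename_eq_subst[of _ u] intro!: subst_cong split: nat.split)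

lemma fv_rename: "fv (rename r t) \<subseteq> r ` fv t"
proof (induction t arbitrary: r)
  case (Lam t)
  show ?case using Lam[of "\<lambda>i. case i of 0 \<Rightarrow> 0 | Suc j \<Rightarrow> Suc (r j)"]
    by (force split: nat.splits)
qed (auto simp: image_Un, blast+)

lemma fv_subst: "fv (subst \<sigma> t) \<subseteq> (\<Union>i\<in>fv t. fv (\<sigma> i))"
proof (induction t arbitrary: \<sigma>)
  case (Lam t)
  show ?case
  proof
    fix i assume "i \<in> fv (subst \<sigma> (Lam t))"
    then obtain j where j: "j \<in> fv t"
      "Suc i \<in> fv (case j of 0 \<Rightarrow> Var 0 | Suc j \<Rightarrow> lift_trm (\<sigma> j))"
      using Lam[of "\<lambda>i. case i of 0 \<Rightarrow> Var 0 | Suc j \<Rightarrow> lift_trm (\<sigma> j)"] by fastforce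
    then obtain j' where "j = Suc j'" by (cases j) auto
    with j fv_rename[of Suc "\<sigma> j'"] show "i \<in> (\<Union>i\<in>fv (Lam t). fv (\<sigma> i))" by auto
  qed
qed (auto, blast+)

lemma fv_inst: "fv (inst u t) \<subseteq> fv (Lam u) \<union> fv t"
  using fv_subst[of "\<lambda>i. case i of 0 \<Rightarrow> t | Suc j \<Rightarrow> Var j" u]
  by (fastforce simp: inst_def split: nat.splits)

section \<open>Iterated application and head reduction\<close>

lemma apps_simps [simp]:
  "apps t [] = t" "apps t (u # us) = apps (App t u) us" "apps (apps t us) vs = apps t (us @ vs)"
  by (auto simp: apps_def)

lemma subst_apps: "subst \<sigma> (apps t us) = apps (subst \<sigma> t) (map (subst \<sigma>) us)"
  by (induction us arbitrary: t) auto

lemma fv_apps: "fv (apps t us) = fv t \<union> (\<Union>u\<in>set us. fv u)"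
  by (induction us arbitrary: t) auto

lemma head_step_subst: "head_step s s' \<Longrightarrow> head_step (subst \<sigma> s) (subst \<sigma> s')"
proof (induction rule: head_step.induct)
  case (head_beta u t ts)
  show ?case by (simp add: subst_apps subst_inst head_step.head_beta del: apps_simps)
next
  case (head_C t ts)
  have "map (\<lambda>t. subst (\<lambda>i. case i of 0 \<Rightarrow> Var 0 | Suc j \<Rightarrow> lift_trm (\<sigma> j)) (lift_trm t)) ts
      = map lift_trm (map (subst \<sigma>) ts)"
    by (simp add: subst_rename rename_subst)
  then show ?case
    using head_step.head_C[of "subst \<sigma> t" "map (subst \<sigma>) ts"]
    by (simp only: subst_apps subst.simps map_map o_def nat.case)
qed

text \<open>Head reduction is not stable under adding an argument, because a \<open>C\<close>-step
  takes the whole stack. Its beta part is, so saturation is stated for this relation alone.\<close>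

inductive wh_step :: "trm \<Rightarrow> trm \<Rightarrow> bool" where
  wh_beta: "wh_step (App (Lam u) t) (inst u t)"
| wh_app: "wh_step t t' \<Longrightarrow> wh_step (App t u) (App t' u)"

lemma head_step_if_wh_step: "wh_step s s' \<Longrightarrow> head_step (apps s us) (apps s' us)"
proof (induction arbitrary: us rule: wh_step.induct)
  case (wh_beta u t)
  show ?case by (rule head_beta)
next
  case (wh_app t t' u)
  show ?case using wh_app.IH[of "u # us"] by simp
qed

lemma beta_if_wh_step: "wh_step s s' \<Longrightarrow> beta s s'"
  by (induction rule: wh_step.induct) (auto intro: beta.intros)

lemma fv_wh_step: "wh_step s s' \<Longrightarrow> fv s' \<subseteq> fv s"
proof (induction rule: wh_step.induct)
  case (wh_beta u t)
  show ?case using fv_inst[of u t] by simp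
qed auto


section \<open>Beta equivalence and Church integers\<close>

lemma beta_equiv_refl: "t \<simeq>\<beta> t"
  by (simp add: beta_equiv_def)

lemma beta_equiv_trans: "t \<simeq>\<beta> u \<Longrightarrow> u \<simeq>\<beta> v \<Longrightarrow> t \<simeq>\<beta> v"
  unfolding beta_equiv_def by (rule equivclp_trans)

lemma beta_equiv_if_wh_step: "wh_step t u \<Longrightarrow> t \<simeq>\<beta> u"
  unfolding beta_equiv_def by (auto dest: beta_if_wh_step)

lemma beta_equiv_map:
  assumes "\<And>t u. beta t u \<Longrightarrow> beta (F t) (F u)" and "t \<simeq>\<beta> u"
  shows "F t \<simeq>\<beta> F u"
  using assms(2) unfolding beta_equiv_def
proof (induction rule: equivclp_induct)
  case (step y z)
  then have "equivclp beta (F y) (F z)" using assms(1) by (auto intro: equivclp_sym)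
  with step.IH show ?case by (rule equivclp_trans)
qed simp

lemma beta_rename: "beta t u \<Longrightarrow> beta (rename r t) (rename r u)"
  by (induction arbitrary: r rule: beta.induct) (auto intro: beta.intros simp: rename_inst)

lemma beta_equiv_rename: "t \<simeq>\<beta> u \<Longrightarrow> rename r t \<simeq>\<beta> rename r u"
  by (rule beta_equiv_map[OF beta_rename])

lemma beta_equiv_Lam: "t \<simeq>\<beta> u \<Longrightarrow> Lam t \<simeq>\<beta> Lam u"
  by (rule beta_equiv_map[OF beta_lam])

lemma beta_equiv_appR: "t \<simeq>\<beta> u \<Longrightarrow> App v t \<simeq>\<beta> App v u"
  by (rule beta_equiv_map[OF beta_appR])

text \<open>The later value of the ordinary variable of \<open>N_type\<close>. Closing under weak
  head expansion rather than beta equivalence makes the set saturated and still lets the outer redex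
  be recovered by induction.\<close>

inductive numeral_body :: "nat \<Rightarrow> nat \<Rightarrow> trm \<Rightarrow> bool" for x f where
  nb_zero: "numeral_body x f (Var x)"
| nb_Suc: "numeral_body x f t \<Longrightarrow> numeral_body x f (App (Var f) t)"
| nb_step: "wh_step t t' \<Longrightarrow> numeral_body x f t' \<Longrightarrow> numeral_body x f t"

lemma numeral_body_equiv: "numeral_body x f t \<Longrightarrow> \<exists>m. t \<simeq>\<beta> (App (Var f) ^^ m) (Var x)"
proof (induction rule: numeral_body.induct)
  case nb_zero
  have "Var x \<simeq>\<beta> (App (Var f) ^^ 0) (Var x)" by (simp add: beta_equiv_refl)
  then show ?case ..
next
  case (nb_Suc t)
  then obtain m where "t \<simeq>\<beta> (App (Var f) ^^ m) (Var x)" by blast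
  then have "App (Var f) t \<simeq>\<beta> (App (Var f) ^^ Suc m) (Var x)" by (simp add: beta_equiv_appR)
  then show ?case ..
next
  case (nb_step t t')
  then show ?case using beta_equiv_if_wh_step beta_equiv_trans by blast
qed

text \<open>With two arguments only \<open>nb_step\<close> can apply; the steps take place inside
  \<open>s\<close> until it is an abstraction that consumes \<open>a\<close>.\<close>

lemma numeral_body_app2:
  assumes "numeral_body x f (App (App s a) b)"
  shows "\<exists>t. s \<simeq>\<beta> Lam t \<and> fv (Lam t) \<subseteq> fv s \<and> numeral_body x f (App (inst t a) b)"
  using assms
proof (induction "App (App s a) b" arbitrary: s rule: numeral_body.induct)
  case (nb_step t')
  from nb_step(1) obtain r where r: "wh_step (App s a) r" "t' = App r b"
    by (cases rule: wh_step.cases) auto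
  from r(1) show ?case
  proof (cases rule: wh_step.cases)
    case (wh_beta u)
    then show ?thesis using nb_step r by (auto intro: beta_equiv_refl)
  next
    case (wh_app s')
    then show ?thesis
      using nb_step(3)[of s'] r fv_wh_step[of s s'] beta_equiv_if_wh_step[of s s']
      by (blast intro: beta_equiv_trans)
  qed
qed

text \<open>With one argument \<open>nb_Suc\<close> could match \<open>s = Var f\<close>; freshness
  of \<open>f\<close> excludes this.\<close>

lemma numeral_body_app1:
  assumes "numeral_body x f (App s (Var f))" and "f \<notin> fv s"
  shows "\<exists>t. s \<simeq>\<beta> Lam t \<and> fv (Lam t) \<subseteq> fv s \<and> numeral_body x f (inst t (Var f))"
  using assms
proof (induction "App s (Var f)" arbitrary: s rule: numeral_body.induct)
  case (nb_step t')
  from nb_step(1) show ?case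
  proof (cases rule: wh_step.cases)
    case (wh_beta u)
    then show ?thesis using nb_step by (auto intro: beta_equiv_refl)
  next
    case (wh_app s')
    then show ?thesis
      using nb_step(3)[of s'] nb_step(4) fv_wh_step[of s s'] beta_equiv_if_wh_step[of s s']
      by (blast intro: beta_equiv_trans)
  qed
qed simp

text \<open>The two inversions strip two abstractions off \<open>u\<close>, with fresh variables for
  the bound ones. Beta equivalence survives renaming, so turning these variables back into indices
  rebuilds the abstractions.\<close>

lemma church_if_numeral_body:
  assumes nb: "numeral_body x f (App (App u (Var x)) (Var f))"
    and "x \<notin> fv u" "f \<notin> fv u" "x \<noteq> f"
  shows "\<exists>m. u \<simeq>\<beta> church m"
proof -
  obtain t where t: "u \<simeq>\<beta> Lam t" "fv (Lam t) \<subseteq> fv u"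
    "numeral_body x f (App (inst t (Var x)) (Var f))"
    using numeral_body_app2[OF nb] by blast
  have f: "f \<notin> fv (inst t (Var x))" using fv_inst[of t "Var x"] t(2) assms(3,4) by auto
  obtain t' where t': "inst t (Var x) \<simeq>\<beta> Lam t'" "fv (Lam t') \<subseteq> fv (inst t (Var x))"
    "numeral_body x f (inst t' (Var f))"
    using numeral_body_app1[OF t(3) f] by blast
  obtain m where m: "inst t' (Var f) \<simeq>\<beta> (App (Var f) ^^ m) (Var x)"
    using numeral_body_equiv[OF t'(3)] by blast
  \<comment> \<open>Under one binder \<open>x\<close> becomes index 0; under both, \<open>f\<close>
    is 0 and \<open>x\<close> is 1, since \<open>church\<close> abstracts the base point
    first.\<close>
  define r where "r j = (if j = x then 0 else Suc j)" for j
  define r' where "r' j = (if j = f then 0 else if j = x then 1 else Suc (Suc j))" for j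
  have "rename r (inst t (Var x)) = rename id t"
    unfolding rename_inst_Var using t(2) assms(2)
    by (intro rename_cong) (auto simp: r_def split: nat.split)
  also have "rename id t = t" by (simp add: rename_eq_subst subst_Var)
  finally have "t \<simeq>\<beta> rename r (Lam t')" using beta_equiv_rename[OF t'(1), of r] by simp
  moreover have "rename r (Lam t') = Lam (rename r' (inst t' (Var f)))"
    unfolding rename_inst_Var using t'(2) f
    by (auto simp: r_def r'_def intro!: rename_cong split: nat.split)
  moreover have "rename r' ((App (Var f) ^^ m) (Var x)) = (App (Var 0) ^^ m) (Var 1)"
    using \<open>x \<noteq> f\<close> by (induction m) (auto simp: r'_def)
  ultimately have "t \<simeq>\<beta> Lam ((App (Var 0) ^^ m) (Var 1))"
    using beta_equiv_rename[OF m, of r'] beta_equiv_Lam beta_equiv_trans by metis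
  then have "u \<simeq>\<beta> church m"
    unfolding church_def using t(1) beta_equiv_Lam beta_equiv_trans by blast
  then show ?thesis ..
qed

section \<open>Realizability\<close>

text \<open>Formulas denote families of sets of terms indexed by worlds. The pole consists of the
  terms that are successful computations at a world; classical values are those that
  are orthogonal to a set of stacks, while ordinary variables range over all saturated values.\<close>

type_synonym 'w sval = "'w \<Rightarrow> trm set"

definition ins_var :: "kind \<Rightarrow> nat \<Rightarrow> nat \<Rightarrow> 'a \<Rightarrow> (kind \<Rightarrow> nat \<Rightarrow> nat \<Rightarrow> 'a) \<Rightarrow> kind \<Rightarrow> nat \<Rightarrow> nat \<Rightarrow> 'a"
  where "ins_var \<kappa> k i P \<eta> = (\<lambda>\<kappa>' k' j.
    if \<kappa>' = \<kappa> \<and> k' = k then if j < i then \<eta> \<kappa>' k' j else if j = i then P else \<eta> \<kappa>' k' (j - 1)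
    else \<eta> \<kappa>' k' j)"

lemma ins_var_commute:
  "ins_var \<kappa>' k' 0 P (ins_var \<kappa> k i Q \<eta>) =
     ins_var \<kappa> k (if \<kappa>' = \<kappa> \<and> k' = k then Suc i else i) Q (ins_var \<kappa>' k' 0 P \<eta>)"
  by (auto simp: ins_var_def fun_eq_iff)

text \<open>Persistence comes from \<open>orth\<close> and \<open>arrow\<close>, which quantify over
  later worlds. The pole need only be closed under head expansion, so weakening of runs to larger
  stores never has to be proved.\<close>

locale realizability_model =
  fixes le :: "'w \<Rightarrow> 'w \<Rightarrow> bool" and pole :: "'w sval"
    and dom :: "'d set" and zero :: 'd and succ :: "'d \<Rightarrow> 'd" and fn :: "'f \<Rightarrow> 'd list \<Rightarrow> 'd"
  assumes le_refl: "le w w"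
    and le_trans: "le w w' \<Longrightarrow> le w' w'' \<Longrightarrow> le w w''"
    and pole_step: "head_step s s' \<Longrightarrow> s' \<in> pole w \<Longrightarrow> s \<in> pole w"
begin

definition upward :: "('w \<Rightarrow> 'a set) \<Rightarrow> bool" where
  "upward S \<longleftrightarrow> (\<forall>w w'. le w w' \<longrightarrow> S w \<subseteq> S w')"

definition saturated :: "'w sval \<Rightarrow> bool" where
  "saturated v \<longleftrightarrow> upward v \<and> (\<forall>w t t'. wh_step t t' \<longrightarrow> t' \<in> v w \<longrightarrow> t \<in> v w)"

definition orth :: "('w \<Rightarrow> trm list set) \<Rightarrow> 'w sval" where
  "orth S w = {t. \<forall>w'. le w w' \<longrightarrow> (\<forall>us\<in>S w'. apps t us \<in> pole w')}"

definition candidate :: "kind \<Rightarrow> 'w sval \<Rightarrow> bool" where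
  "candidate \<kappa> v \<longleftrightarrow> (case \<kappa> of Ord \<Rightarrow> saturated v | Cls \<Rightarrow> \<exists>S. upward S \<and> v = orth S)"

definition arrow :: "'w sval \<Rightarrow> 'w sval \<Rightarrow> 'w sval" where
  "arrow v v' w = {t. \<forall>w'. le w w' \<longrightarrow> (\<forall>u\<in>v w'. App t u \<in> v' w')}"

primrec ev :: "(nat \<Rightarrow> 'd) \<Rightarrow> 'f tm \<Rightarrow> 'd" where
  "ev \<rho> (FVar i) = \<rho> i"
| "ev \<rho> Zero = zero"
| "ev \<rho> (Succ t) = succ (ev \<rho> t)"
| "ev \<rho> (Fn g ts) = fn g (map (ev \<rho>) ts)"

text \<open>No rule concerns predicate constants in particular, so they can be given a trivial
  value, the set of all terms.\<close>

primrec sem :: "(nat \<Rightarrow> 'd) \<Rightarrow> (kind \<Rightarrow> nat \<Rightarrow> nat \<Rightarrow> 'd list \<Rightarrow> 'w sval) \<Rightarrow> ('f, 'p) fm \<Rightarrow> 'w sval" where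
  "sem \<rho> \<eta> Bot = orth (\<lambda>w. {[]})"
| "sem \<rho> \<eta> (PVar \<kappa> i ts) = \<eta> \<kappa> (length ts) i (map (ev \<rho>) ts)"
| "sem \<rho> \<eta> (PConst p ts) = (\<lambda>w. UNIV)"
| "sem \<rho> \<eta> (A \<^bold>\<rightarrow> B) = arrow (sem \<rho> \<eta> A) (sem \<rho> \<eta> B)"
| "sem \<rho> \<eta> (All1 A) = (\<lambda>w. \<Inter>d\<in>dom. sem (case_nat d \<rho>) \<eta> A w)"
| "sem \<rho> \<eta> (All2 \<kappa> k A) =
     (\<lambda>w. \<Inter>P\<in>{P. \<forall>ds. candidate \<kappa> (P ds)}. sem \<rho> (ins_var \<kappa> k 0 P \<eta>) A w)"

definition adm_env :: "(kind \<Rightarrow> nat \<Rightarrow> nat \<Rightarrow> 'd list \<Rightarrow> 'w sval) \<Rightarrow> bool" where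
  "adm_env \<eta> \<longleftrightarrow> (\<forall>\<kappa> k i ds. candidate \<kappa> (\<eta> \<kappa> k i ds))"

lemma adm_env_ins_var: "adm_env \<eta> \<Longrightarrow> \<forall>ds. candidate \<kappa> (P ds) \<Longrightarrow> adm_env (ins_var \<kappa> k i P \<eta>)"
  by (auto simp: adm_env_def ins_var_def)

section \<open>Closure properties of saturated and classical values\<close>

lemma saturated_orth: "saturated (orth S)"
  unfolding saturated_def upward_def orth_def
  using le_trans pole_step head_step_if_wh_step by blast

lemma orth_mono: "t \<in> orth S w \<Longrightarrow> le w w' \<Longrightarrow> t \<in> orth S w'"
  using le_trans by (auto simp: orth_def)

lemma orth_apps: "t \<in> orth S w \<Longrightarrow> us \<in> S w \<Longrightarrow> apps t us \<in> pole w"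
  using le_refl by (auto simp: orth_def)

lemma arrow_mono: "t \<in> arrow v v' w \<Longrightarrow> le w w' \<Longrightarrow> t \<in> arrow v v' w'"
  using le_trans by (auto simp: arrow_def)

lemma arrow_App: "t \<in> arrow v v' w \<Longrightarrow> u \<in> v w \<Longrightarrow> App t u \<in> v' w"
  using le_refl by (auto simp: arrow_def)

lemma saturated_candidate: "candidate \<kappa> v \<Longrightarrow> saturated v"
  by (auto simp: candidate_def saturated_orth split: kind.splits)

lemma candidate_ClsI: "upward S \<Longrightarrow> candidate Cls (orth S)"
  by (auto simp: candidate_def)

lemma saturated_Inter: "(\<And>i. i \<in> I \<Longrightarrow> saturated (v i)) \<Longrightarrow> saturated (\<lambda>w. \<Inter>i\<in>I. v i w)"
  by (simp add: saturated_def upward_def) (meson INT_lower INT_greatest order_trans)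

text \<open>An intersection of orthogonals is the orthogonal of the union of the stack sets.\<close>

lemma candidate_Cls_Inter:
  assumes "\<And>i. i \<in> I \<Longrightarrow> candidate Cls (v i)"
  shows "candidate Cls (\<lambda>w. \<Inter>i\<in>I. v i w)"
proof -
  obtain S where S: "\<And>i. i \<in> I \<Longrightarrow> upward (S i) \<and> v i = orth (S i)"
    using assms unfolding candidate_def kind.case by metis
  have "(\<lambda>w. \<Inter>i\<in>I. v i w) = orth (\<lambda>w. \<Union>i\<in>I. S i w)"
    using S by (auto simp: orth_def fun_eq_iff)
  moreover have "upward (\<lambda>w. \<Union>i\<in>I. S i w)" using S unfolding upward_def by blast
  ultimately show ?thesis using candidate_ClsI by metis
qed

lemma saturated_arrow: "saturated v' \<Longrightarrow> saturated (arrow v v')"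
  unfolding saturated_def upward_def arrow_def using le_trans wh_app by blast

text \<open>An arrow into \<open>orth S\<close> is the orthogonal of the stacks
  \<open>u # us\<close> with \<open>u\<close> in \<open>v\<close> and \<open>us\<close> in
  \<open>S\<close>.\<close>

lemma candidate_Cls_arrow:
  assumes "saturated v" "candidate Cls v'"
  shows "candidate Cls (arrow v v')"
proof -
  obtain S where S: "upward S" "v' = orth S" using assms(2) by (auto simp: candidate_def)
  let ?S = "\<lambda>w. {u # us | u us. u \<in> v w \<and> us \<in> S w}"
  have v: "\<And>w w'. le w w' \<Longrightarrow> v w \<subseteq> v w'" using assms(1) by (auto simp: saturated_def upward_def)
  have "arrow v v' = orth ?S"
  proof (rule ext, rule subset_antisym)
    fix w
    show "arrow v v' w \<subseteq> orth ?S w"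
      using le_refl by (fastforce simp: S arrow_def orth_def)
    show "orth ?S w \<subseteq> arrow v v' w"
    proof
      fix t assume t: "t \<in> orth ?S w"
      have "apps (App t u) us \<in> pole w''"
        if w: "le w w'" "u \<in> v w'" "le w' w''" "us \<in> S w''" for w' u w'' us
      proof -
        \<comment> \<open>The argument is given at \<open>w'\<close>, the stack at
          \<open>w''\<close>; persistence of \<open>v\<close> brings both to one world.\<close>
        have "le w w''" "u # us \<in> ?S w''" using le_trans w v[OF w(3)] by auto
        then have "apps t (u # us) \<in> pole w''" using t unfolding orth_def by blast
        then show ?thesis by simp
      qed
      then show "t \<in> arrow v v' w" by (simp add: S arrow_def orth_def)
    qed
  qed
  moreover have "upward ?S" using S(1) v unfolding upward_def by blast
  ultimately show ?thesis using candidate_ClsI[of ?S] by simp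
qed

lemma saturated_sem: "adm_env \<eta> \<Longrightarrow> saturated (sem \<rho> \<eta> A)"
proof (induction A arbitrary: \<rho> \<eta>)
  case (PVar \<kappa> i ts)
  then show ?case by (simp add: adm_env_def) (metis saturated_candidate)
qed (auto simp: saturated_orth adm_env_ins_var intro!: saturated_arrow saturated_Inter,
    simp add: saturated_def upward_def)

text \<open>Orthogonality passes from the end of a type through arrows and quantifiers. Hence
  classical types may instantiate classical variables.\<close>

lemma candidate_Cls_sem: "adm_env \<eta> \<Longrightarrow> classical A \<Longrightarrow> candidate Cls (sem \<rho> \<eta> A)"
proof (induction A arbitrary: \<rho> \<eta>)
  case Bot
  show ?case by (simp add: candidate_ClsI upward_def)
next
  case (PVar \<kappa> i ts)
  then show ?case by (auto simp: adm_env_def)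
qed (auto simp: saturated_sem adm_env_ins_var intro!: candidate_Cls_arrow candidate_Cls_Inter)

section \<open>Substitution as change of environment\<close>

lemma ev_tsubst: "ev \<rho> (tsubst \<sigma> t) = ev (\<lambda>i. ev \<rho> (\<sigma> i)) t"
  by (induction t) (auto simp: o_def cong: map_cong)

lemma sem_fsubst: "sem \<rho> \<eta> (fsubst \<sigma> A) = sem (\<lambda>i. ev \<rho> (\<sigma> i)) \<eta> A"
proof (induction A arbitrary: \<rho> \<eta> \<sigma>)
  case (All1 A)
  have "(\<lambda>i. ev (case_nat d \<rho>) (case i of 0 \<Rightarrow> FVar 0 | Suc j \<Rightarrow> tsubst (\<lambda>n. FVar (Suc n)) (\<sigma> j)))
      = case_nat d (\<lambda>i. ev \<rho> (\<sigma> i))" for d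
    by (auto simp: ev_tsubst split: nat.split)
  then show ?case by (simp add: All1.IH)
qed (auto simp: ev_tsubst o_def)

lemma sem_finst: "sem \<rho> \<eta> (finst A u) = sem (case_nat (ev \<rho> u) \<rho>) \<eta> A"
  unfolding finst_def sem_fsubst
  by (rule arg_cong[where f = "\<lambda>\<rho>. sem \<rho> \<eta> A"]) (auto split: nat.split)

lemma sem_flift0: "sem (case_nat d \<rho>) \<eta> (flift 0 A) = sem \<rho> \<eta> A"
  by (simp add: flift_def sem_fsubst)

lemma sem_plift: "sem \<rho> (ins_var \<kappa> k c P \<eta>) (plift \<kappa> k c A) = sem \<rho> \<eta> A"
proof (induction A arbitrary: \<rho> \<eta> c)
  case (All2 \<kappa>' k' A)
  show ?case by (simp only: plift.simps sem.simps ins_var_commute All2.IH)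
qed (auto simp: ins_var_def)

definition param_val where
  "param_val k \<rho> ds = (\<lambda>j. if j < k then ds ! j else \<rho> (j - k))"

lemma sem_psubst:
  "sem \<rho> \<eta> (psubst \<kappa> k i G A) =
     sem \<rho> (ins_var \<kappa> k i (\<lambda>ds. sem (param_val k \<rho> ds) \<eta> G) \<eta>) A"
proof (induction A arbitrary: \<rho> \<eta> i G)
  case (PVar \<kappa>' j ts)
  have "(\<lambda>i. ev \<rho> (if i < length ts then ts ! i else FVar (i - length ts)))
      = param_val (length ts) \<rho> (map (ev \<rho>) ts)"
    by (auto simp: param_val_def)
  then show ?case by (auto simp: ins_var_def param_inst_def sem_fsubst)
next
  case (All1 A)
  have "(\<lambda>i. ev (param_val k (case_nat d \<rho>) ds) (FVar (if i < k then i else Suc i)))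
      = param_val k \<rho> ds" for d ds
    by (auto simp: param_val_def Suc_diff_le)
  then show ?case by (simp add: All1.IH flift_def sem_fsubst del: ev.simps)
next
  case (All2 \<kappa>' k' A)
  show ?case by (simp only: psubst.simps sem.simps All2.IH sem_plift ins_var_commute)
qed simp_all

text \<open>\<open>dom\<close> and \<open>eqs\<close> serve the elimination of \<open>All1\<close>
  and the equational rule; each of the two models discharges them in its own way.\<close>

theorem soundness:
  fixes A :: "('f, 'p) fm"
  assumes "typ_M2 L E \<Gamma> t A"
    and dom: "\<And>\<rho> u. \<forall>i. \<rho> i \<in> dom \<Longrightarrow> wf_tm L u \<Longrightarrow> ev \<rho> u \<in> dom"
    and eqs: "\<And>\<rho> u v. \<forall>i. \<rho> i \<in> dom \<Longrightarrow> eq_entails L E u v \<Longrightarrow> ev \<rho> u = ev \<rho> v"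
    and "\<forall>i. \<rho> i \<in> dom" "adm_env \<eta>" "\<forall>i<length \<Gamma>. \<sigma> i \<in> sem \<rho> \<eta> (\<Gamma> ! i) w"
  shows "subst \<sigma> t \<in> sem \<rho> \<eta> A w"
  using assms(1,4-)
proof (induction arbitrary: \<rho> \<eta> \<sigma> w rule: typ_M2.induct)
  case (M2_ax \<Gamma> i)
  then show ?case by simp
next
  case (M2_C \<Gamma>)
  have "Cst \<in> arrow (arrow (arrow v (orth (\<lambda>w. {[]}))) (orth (\<lambda>w. {[]}))) v w"
    if v: "candidate Cls v" for v
  proof -
    obtain S where S: "upward S" "v = orth S" using v by (auto simp: candidate_def)
    show ?thesis
    proof (clarsimp simp: arrow_def S(2) orth_def[of S])
      fix w' t w'' us
      assume t: "\<forall>w''. le w' w'' \<longrightarrow> (\<forall>u. (\<forall>w'. le w'' w' \<longrightarrow>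
            (\<forall>t. (\<forall>w''. le w' w'' \<longrightarrow> (\<forall>us\<in>S w''. apps t us \<in> pole w'')) \<longrightarrow>
              App u t \<in> orth (\<lambda>w. {[]}) w')) \<longrightarrow> App t u \<in> orth (\<lambda>w. {[]}) w'')"
        and w: "le w' w''" "us \<in> S w''"
      \<comment> \<open>\<open>?k\<close> is what the \<open>C\<close>-step hands to
        \<open>t\<close>. Applied to any \<open>u\<close> in the candidate it restores the stack
        \<open>us\<close>, so it realizes the negation of the candidate.\<close>
      let ?k = "Lam (apps (Var 0) (map lift_trm us))"
      have "App ?k u \<in> orth (\<lambda>w. {[]}) w1"
        if w1: "le w'' w1" and u: "\<forall>w2. le w1 w2 \<longrightarrow> (\<forall>us\<in>S w2. apps u us \<in> pole w2)" for w1 u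
      proof (clarsimp simp: orth_def)
        fix w2 assume "le w1 w2"
        then have "apps u us \<in> pole w2" using S(1) w w1 u unfolding upward_def by (meson le_trans subsetD)
        moreover have "inst (apps (Var 0) (map lift_trm us)) u = apps u us"
          by (simp add: inst_def subst_apps subst_rename subst_Var o_def)
        ultimately show "App ?k u \<in> pole w2"
          using pole_step[OF head_step_if_wh_step[OF wh_beta, of _ _ "[]"]] by simp
      qed
      then have "App t ?k \<in> orth (\<lambda>w. {[]}) w''" using t w by blast
      then have "App t ?k \<in> pole w''" using le_refl by (auto simp: orth_def)
      then show "apps (App Cst t) us \<in> pole w''" using pole_step head_C by blast
    qed
  qed
  then show ?case by (auto simp: C_type_def ins_var_def)
next
  case (M2_impI A \<Gamma> t B)
  show ?case
  proof (clarsimp simp: arrow_def)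
    fix w' u assume w: "le w w'" "u \<in> sem \<rho> \<eta> A w'"
    have "\<forall>i<length \<Gamma>. \<sigma> i \<in> sem \<rho> \<eta> (\<Gamma> ! i) w'"
      using M2_impI.prems w(1) saturated_sem unfolding saturated_def upward_def by blast
    then have "\<forall>i<length (A # \<Gamma>). case_nat u \<sigma> i \<in> sem \<rho> \<eta> ((A # \<Gamma>) ! i) w'"
      using w(2) by (auto split: nat.split)
    then have "subst (case_nat u \<sigma>) t \<in> sem \<rho> \<eta> B w'" using M2_impI by blast
    then have "inst (subst (\<lambda>i. case i of 0 \<Rightarrow> Var 0 | Suc j \<Rightarrow> lift_trm (\<sigma> j)) t) u
        \<in> sem \<rho> \<eta> B w'"
      by (simp only: inst_subst_lift)
    then show "App (Lam (subst (case_nat (Var 0) (\<lambda>j. lift_trm (\<sigma> j))) t)) u \<in> sem \<rho> \<eta> B w'"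
      using saturated_sem[OF M2_impI.prems(2), of \<rho> B] wh_beta unfolding saturated_def by blast
  qed
next
  case (M2_impE \<Gamma> t A B u)
  then have "subst \<sigma> t \<in> arrow (sem \<rho> \<eta> A) (sem \<rho> \<eta> B) w" "subst \<sigma> u \<in> sem \<rho> \<eta> A w" by auto
  then show ?case using le_refl by (auto simp: arrow_def)
next
  case (M2_all1I \<Gamma> t A)
  have "subst \<sigma> t \<in> sem (case_nat d \<rho>) \<eta> A w" if "d \<in> dom" for d
    using that M2_all1I.prems by (intro M2_all1I.IH) (auto simp: sem_flift0 split: nat.split)
  then show ?case by simp
next
  case (M2_all1E \<Gamma> t A u)
  then show ?case using dom by (auto simp: sem_finst)
next
  case (M2_all2I \<kappa> k \<Gamma> t A)
  have "subst \<sigma> t \<in> sem \<rho> (ins_var \<kappa> k 0 P \<eta>) A w" if "\<forall>ds. candidate \<kappa> (P ds)" for P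
    using that M2_all2I.prems by (intro M2_all2I.IH) (auto simp: sem_plift adm_env_ins_var)
  then show ?case by simp
next
  case (M2_all2E_Ord \<Gamma> t k A G)
  have "candidate Ord (sem (param_val k \<rho> ds) \<eta> G)" for ds
    using saturated_sem M2_all2E_Ord.prems by (simp add: candidate_def)
  moreover have "subst \<sigma> t \<in> sem \<rho> \<eta> (All2 Ord k A) w" using M2_all2E_Ord by blast
  ultimately show ?case by (simp add: sem_psubst)
next
  case (M2_all2E_Cls \<Gamma> t k A G)
  have "candidate Cls (sem (param_val k \<rho> ds) \<eta> G)" for ds
    using candidate_Cls_sem M2_all2E_Cls by blast
  moreover have "subst \<sigma> t \<in> sem \<rho> \<eta> (All2 Cls k A) w" using M2_all2E_Cls by blast
  ultimately show ?case by (simp add: sem_psubst)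
next
  case (M2_eq \<Gamma> t A u v)
  then have "subst \<sigma> t \<in> sem \<rho> \<eta> (finst A u) w" by blast
  moreover have "ev \<rho> u = ev \<rho> v" using M2_eq by (intro eqs)
  ultimately show ?case by (simp add: sem_finst)
qed

end

section \<open>Classical integers\<close>

lemma wf_tsubst: "wf_tm L t \<Longrightarrow> \<forall>i. wf_tm L (\<sigma> i) \<Longrightarrow> wf_tm L (tsubst \<sigma> t)"
  by (induction t) auto

lemma tsubst_tsubst: "tsubst \<sigma> (tsubst \<sigma>' t) = tsubst (\<lambda>i. tsubst \<sigma> (\<sigma>' i)) t"
  by (induction t) auto

lemma eq_entails_wf:
  assumes "equations_over L E" "eq_entails L E a b"
  shows "wf_tm L a \<and> wf_tm L b"
  using assms(2)
proof (induction rule: eq_entails.induct)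
  case (eq_ax u v \<sigma>)
  then show ?case using assms(1) by (auto simp: equations_over_def intro: wf_tsubst)
next
  case (eq_Fn g as bs)
  then show ?case by (auto simp: list_all2_conv_all_nth in_set_conv_nth)
qed auto

lemma eq_entails_tsubst:
  assumes "eq_entails L E a b" "\<forall>i. wf_tm L (\<sigma> i)"
  shows "eq_entails L E (tsubst \<sigma> a) (tsubst \<sigma> b)"
  using assms(1)
proof (induction rule: eq_entails.induct)
  case (eq_ax u v \<sigma>')
  then show ?case using assms(2) by (simp add: tsubst_tsubst wf_tsubst eq_entails.eq_ax)
next
  case (eq_Fn g as bs)
  have "list_all2 (eq_entails L E) (map (tsubst \<sigma>) as) (map (tsubst \<sigma>) bs)"
    using eq_Fn(2) by (auto simp: list_all2_conv_all_nth)
  then show ?case using eq_Fn(1) by (simp add: eq_entails.eq_Fn)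
next
  case (eq_trans a b c)
  then show ?case by (blast intro: eq_entails.eq_trans)
qed (auto simp: wf_tsubst assms(2) intro: eq_entails.eq_refl eq_entails.eq_sym eq_entails.eq_Succ)

text \<open>Equal terms have the same set of equals, so the choice gives them one representative,
  and entailed equality becomes equality in the domain of the model.\<close>

definition normal_tm :: "('f, 'p) language \<Rightarrow> ('f tm \<times> 'f tm) set \<Rightarrow> 'f tm \<Rightarrow> 'f tm" where
  "normal_tm L E t = (SOME u. eq_entails L E t u)"

lemma normal_tm_equiv: "wf_tm L t \<Longrightarrow> eq_entails L E t (normal_tm L E t)"
  unfolding normal_tm_def by (rule someI[of _ t]) (rule eq_refl)

lemma normal_tm_cong: "eq_entails L E t u \<Longrightarrow> normal_tm L E t = normal_tm L E u"
proof -
  assume "eq_entails L E t u"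
  then have "eq_entails L E t = eq_entails L E u" by (intro ext) (metis eq_sym eq_trans)
  then show ?thesis by (simp add: normal_tm_def)
qed

lemma normal_tm_eqD:
  assumes "normal_tm L E t = normal_tm L E u" "wf_tm L t" "wf_tm L u"
  shows "eq_entails L E t u"
  using assms normal_tm_equiv by (metis eq_sym eq_trans)

text \<open>By soundness, with the predicate variable of \<open>NC_at\<close> denoting the
  orthogonal of \<open>Y k\<close> at the numeral of \<open>k\<close> and all terms
  elsewhere.\<close>

theorem classical_integer_induction:
  fixes L :: "('f, 'p) language" and E :: "('f tm \<times> 'f tm) set"
    and Y :: "nat \<Rightarrow> trm list set"
  assumes E: "equations_over L E" "adequate L E"
    and \<theta>: "classical_integer L E n \<theta>"
    and R: "\<And>s s'. head_step s s' \<Longrightarrow> s' \<in> R \<Longrightarrow> s \<in> R"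
    and a: "\<forall>us\<in>Y 0. apps a us \<in> R"
    and b: "\<And>k u. \<forall>us\<in>Y k. apps u us \<in> R \<Longrightarrow> \<forall>us\<in>Y (Suc k). apps (App b u) us \<in> R"
  shows "\<forall>us\<in>Y n. apps (App (App \<theta> a) b) us \<in> R"
proof -
  let ?nf = "normal_tm L E"
  let ?D = "?nf ` {t. wf_tm L t}"
  have D: "wf_tm L d \<and> ?nf d = d" if d: "d \<in> ?D" for d
  proof -
    obtain t where t: "wf_tm L t" "d = ?nf t" using d by blast
    then have td: "eq_entails L E t d" using normal_tm_equiv by simp
    then have "wf_tm L d" using eq_entails_wf[OF E(1)] by blast
    then show ?thesis using t(2) normal_tm_cong[OF td] by metis
  qed
  then have Dwf: "d \<in> ?D \<Longrightarrow> wf_tm L d" and Dnf: "d \<in> ?D \<Longrightarrow> ?nf d = d" for d by blast+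
  interpret M: realizability_model "\<lambda>_ _. True" "\<lambda>_::unit. R" ?D "?nf Zero"
    "\<lambda>d. ?nf (Succ d)" "\<lambda>g ds. ?nf (Fn g ds)"
    by unfold_locales (auto intro: R)
  have ev: "M.ev \<rho> t = ?nf (tsubst \<rho> t)" if \<rho>: "\<forall>i. \<rho> i \<in> ?D" and "wf_tm L t" for \<rho> t
    using that(2)
  proof (induction t)
    case (FVar i)
    then show ?case using \<rho> Dnf by (metis M.ev.simps(1) tsubst.simps(1))
  next
    case Zero
    then show ?case by simp
  next
    case (Succ t)
    have "wf_tm L (tsubst \<rho> t)" using Succ.prems \<rho> Dwf wf_tsubst by (metis wf_tm.simps(3))
    then have "eq_entails L E (Succ (?nf (tsubst \<rho> t))) (Succ (tsubst \<rho> t))"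
      by (intro eq_Succ eq_sym[OF normal_tm_equiv])
    then show ?case using Succ by (simp add: normal_tm_cong)
  next
    case (Fn g ts)
    have ts: "M.ev \<rho> t = ?nf (tsubst \<rho> t) \<and> wf_tm L (tsubst \<rho> t)" if "t \<in> set ts" for t
    proof -
      have "wf_tm L t" using Fn.prems that by simp
      then show ?thesis using Fn.IH that \<rho> Dwf wf_tsubst by metis
    qed
    then have "list_all2 (eq_entails L E) (map (M.ev \<rho>) ts) (map (tsubst \<rho>) ts)"
      by (auto simp: list_all2_conv_all_nth intro: eq_sym[OF normal_tm_equiv])
    then have "eq_entails L E (Fn g (map (M.ev \<rho>) ts)) (Fn g (map (tsubst \<rho>) ts))"
      using Fn.prems by (intro eq_Fn) auto
    then show ?case using normal_tm_cong by (simp only: M.ev.simps tsubst.simps)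
  qed
  have dom: "M.ev \<rho> u \<in> ?D" if "\<forall>i. \<rho> i \<in> ?D" "wf_tm L u" for \<rho> u
    using ev[OF that] wf_tsubst[OF that(2)] Dwf that(1) by blast
  have eqs: "M.ev \<rho> u = M.ev \<rho> v" if \<rho>: "\<forall>i. \<rho> i \<in> ?D" and uv: "eq_entails L E u v" for \<rho> u v
  proof -
    have "eq_entails L E (tsubst \<rho> u) (tsubst \<rho> v)"
      using eq_entails_tsubst[OF uv] \<rho> Dwf by blast
    then show ?thesis
      using ev[OF \<rho>] eq_entails_wf[OF E(1) uv] normal_tm_cong by metis
  qed
  define num where "num k = ?nf ((Succ ^^ k) Zero)" for k
  have wf_num: "wf_tm L ((Succ ^^ k) Zero)" for k by (induction k) auto
  have num_Suc: "?nf (Succ (num k)) = num (Suc k)" for k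
  proof -
    have "eq_entails L E (Succ (num k)) (Succ ((Succ ^^ k) Zero))"
      unfolding num_def by (intro eq_Succ eq_sym[OF normal_tm_equiv] wf_num)
    then show ?thesis using normal_tm_cong by (simp add: num_def)
  qed
  have num_D: "num k \<in> ?D" for k using wf_num by (simp add: num_def)
  have ev_num: "M.ev \<rho> ((Succ ^^ k) Zero) = num k" for \<rho> k
    by (induction k) (use num_Suc in \<open>auto simp: num_def\<close>)
  \<comment> \<open>Adequacy enters here: its first half excludes \<open>k = 0\<close>, its second
    half makes \<open>d\<close> a numeral.\<close>
  have succ_num: "\<exists>k'. k = Suc k' \<and> d = num k'" if d: "d \<in> ?D" and k: "?nf (Succ d) = num k" for d k
  proof (cases k)
    case 0
    then have "eq_entails L E (Succ d) Zero"
      using k Dwf[OF d] by (intro normal_tm_eqD) (auto simp: num_def)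
    then show ?thesis using E(2) Dwf[OF d] by (auto simp: adequate_def)
  next
    case (Suc k')
    then have "?nf (Succ d) = ?nf (Succ (num k'))" using k num_Suc by simp
    then have "eq_entails L E (Succ d) (Succ (num k'))"
      by (rule normal_tm_eqD) (use Dwf[OF d] Dwf[OF num_D] in auto)
    then have "eq_entails L E d (num k')" using E(2) Dwf[OF d] Dwf[OF num_D] by (auto simp: adequate_def)
    then have "d = num k'" using Dnf[OF d] Dnf[OF num_D] normal_tm_cong by metis
    then show ?thesis using Suc by simp
  qed
  have num_inj: "num j = num k \<Longrightarrow> j = k" for j k
  proof (induction j arbitrary: k)
    case 0
    show ?case
    proof (cases k)
      case (Suc k')
      then show ?thesis using 0 succ_num[OF num_D, of k' 0] num_Suc by auto
    qed simp
  next
    case (Suc j)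
    then show ?case using succ_num[OF num_D, of j k] num_Suc by auto
  qed
  \<comment> \<open>Off the numerals there is no stack, so the orthogonal is everything; at a
    numeral, injectivity of \<open>num\<close> makes \<open>k\<close> unique.\<close>
  define P where "P ds = M.orth (\<lambda>_. {us. \<exists>k. ds = [num k] \<and> us \<in> Y k})" for ds
  have P: "M.candidate Cls (P ds)" for ds
    by (simp add: P_def M.candidate_ClsI M.upward_def)
  have P_num: "t \<in> P [num k] () \<longleftrightarrow> (\<forall>us\<in>Y k. apps t us \<in> R)" for t k
    using num_inj by (auto simp: P_def M.orth_def)
  \<comment> \<open>The type is closed, so the environment is arbitrary; the orthogonal of no stacks
    is a candidate of either kind.\<close>
  let ?\<rho> = "\<lambda>_::nat. num 0" and ?\<eta> = "\<lambda>(_::kind) (_::nat) (_::nat) (_::'f tm list). M.orth (\<lambda>_. {})"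
  have "M.candidate \<kappa> (M.orth (\<lambda>_. {}))" for \<kappa>
    by (cases \<kappa>) (auto simp: M.candidate_def M.saturated_orth M.upward_def)
  then have \<eta>: "M.adm_env ?\<eta>" by (simp add: M.adm_env_def)
  have "typ_M2 L E [] \<theta> (NC_at ((Succ ^^ n) Zero))" using \<theta> by (simp add: classical_integer_def)
  then have "subst Var \<theta> \<in> M.sem ?\<rho> ?\<eta> (NC_at ((Succ ^^ n) Zero) :: ('f, 'p) fm) ()"
    by (rule M.soundness) (use dom eqs num_D \<eta> in auto)
  then have "\<theta> \<in> M.arrow (P [num 0]) (M.arrow
      (\<lambda>w. \<Inter>d\<in>?D. M.arrow (P [d]) (P [?nf (Succ d)]) w) (P [num n])) ()"
    using P by (simp add: subst_Var NC_at_def ins_var_def ev_num) (simp add: num_def)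
  moreover have "a \<in> P [num 0] ()" using a by (simp add: P_num)
  \<comment> \<open>The type quantifies over the whole domain. A successor that is a numeral has a
    numeral predecessor, where \<open>b\<close> helps; any other successor demands nothing.\<close>
  moreover have "App b u \<in> P [?nf (Succ d)] ()" if d: "d \<in> ?D" and u: "u \<in> P [d] ()" for d u
  proof (cases "\<exists>k. ?nf (Succ d) = num k")
    case True
    then obtain k where k: "?nf (Succ d) = num (Suc k)" "d = num k" using succ_num[OF d] by blast
    then show ?thesis using u b[of k u] by (simp add: P_num del: apps_simps)
  next
    case False
    then show ?thesis by (auto simp: P_def M.orth_def)
  qed
  ultimately have "App (App \<theta> a) b \<in> P [num n] ()" by (auto simp: M.arrow_def)
  then show ?thesis by (simp add: P_num del: apps_simps)
qed

definition orth_closed :: "trm set \<Rightarrow> trm \<Rightarrow> trm \<Rightarrow> (nat \<Rightarrow> trm list set) \<Rightarrow> bool" where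
  "orth_closed R a b Y \<longleftrightarrow> (\<forall>us\<in>Y 0. apps a us \<in> R) \<and>
     (\<forall>j u. (\<forall>us\<in>Y j. apps u us \<in> R) \<longrightarrow> (\<forall>us\<in>Y (Suc j). apps (App b u) us \<in> R))"

text \<open>Impredicative, mirroring \<open>NC_at\<close>: membership in every classical family that
  contains \<open>a\<close> at 0 and is preserved by \<open>b\<close>. It does not say that
  \<open>t\<close> reduces to an iterate, which leaves room for backtracking.\<close>

definition iterates :: "trm set \<Rightarrow> trm \<Rightarrow> trm \<Rightarrow> nat \<Rightarrow> trm set" where
  "iterates R a b k = {t. \<forall>Y. orth_closed R a b Y \<longrightarrow> (\<forall>us\<in>Y k. apps t us \<in> R)}"

text \<open>The test family has the stack \<open>us\<close> at 0 and nothing above, so closure under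
  \<open>b\<close> is trivial.\<close>

lemma iterates_zero:
  assumes "t \<in> iterates R a b 0" "apps a us \<in> R"
  shows "apps t us \<in> R"
proof -
  have "orth_closed R a b (\<lambda>j. if j = 0 then {us} else {})"
    using assms(2) by (simp add: orth_closed_def)
  then show ?thesis using assms(1) by (fastforce simp: iterates_def)
qed

lemma iterates_Suc:
  assumes t: "t \<in> iterates R a b (Suc k)"
    and b: "\<And>u. u \<in> iterates R a b k \<Longrightarrow> apps (App b u) us \<in> R"
  shows "apps t us \<in> R"
proof -
  define Z where "Z j = {us. \<forall>t\<in>iterates R a b j. apps t us \<in> R}" for j
  \<comment> \<open>\<open>Z\<close> is the family orthogonal to the iterates themselves; it stays closed when the single stack
    \<open>us\<close> is added at \<open>Suc k\<close>.\<close>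
  let ?Y = "\<lambda>j. if j = Suc k then insert us (Z j) else Z j"
  have a: "a \<in> iterates R a b 0" by (simp add: iterates_def orth_closed_def)
  have step: "App b u \<in> iterates R a b (Suc j)" if "u \<in> iterates R a b j" for u j
    unfolding iterates_def
  proof (intro CollectI allI impI)
    fix Y assume Y: "orth_closed R a b Y"
    then have "\<forall>us\<in>Y j. apps u us \<in> R" using that unfolding iterates_def by blast
    with Y show "\<forall>us\<in>Y (Suc j). apps (App b u) us \<in> R"
      unfolding orth_closed_def by meson
  qed
  \<comment> \<open>Every closed family lies inside \<open>Z\<close>, so a term orthogonal to
    \<open>Z j\<close> is orthogonal to level \<open>j\<close> of all of them.\<close>
  have Z: "u \<in> iterates R a b j" if u: "\<forall>us\<in>Z j. apps u us \<in> R" for u j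
  proof -
    have "apps u vs \<in> R" if "orth_closed R a b Y" "vs \<in> Y j" for Y vs
    proof -
      have "vs \<in> Z j" using that unfolding Z_def iterates_def by blast
      then show ?thesis using u by blast
    qed
    then show ?thesis unfolding iterates_def by blast
  qed
  have "\<forall>vs\<in>?Y 0. apps a vs \<in> R" using a by (auto simp: Z_def)
  moreover have "\<forall>vs\<in>?Y (Suc j). apps (App b u) vs \<in> R" if "\<forall>vs\<in>?Y j. apps u vs \<in> R" for j u
  proof -
    have "u \<in> iterates R a b j" using that by (intro Z) (auto split: if_splits)
    then show ?thesis using step[of u j] b by (auto simp: Z_def)
  qed
  ultimately have "orth_closed R a b ?Y" unfolding orth_closed_def by blast
  then have "\<forall>vs\<in>?Y (Suc k). apps t vs \<in> R" using t unfolding iterates_def by blast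
  then show ?thesis by simp
qed


section \<open>Running the program on a generic integer\<close>

text \<open>Variable \<open>0\<close> stands for \<open>f\<close> and variable \<open>1\<close> for an unknown classical integer of
  value \<open>n\<close>. An entry \<open>(y, k, a, b)\<close> of the store declares \<open>y\<close> to be an unknown
  iterate of value \<open>k\<close>, which either hands over to \<open>a\<close> or applies \<open>b\<close> to a new
  unknown of value \<open>k - 1\<close>.\<close>

type_synonym store = "(nat \<times> nat \<times> trm \<times> trm) list"

definition used :: "store \<Rightarrow> trm \<Rightarrow> nat set" where
  "used w s = {0, 1} \<union> fv s \<union> (\<Union>(y, k, a, b)\<in>set w. insert y (fv a \<union> fv b))"

lemma fresh_exists: "\<exists>z. z \<notin> used w s"
proof -
  have "finite (used w s)" by (auto simp: used_def finite_fv)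
  then show ?thesis by (rule ex_new_if_finite[OF infinite_UNIV_nat])
qed

inductive runs_to :: "nat \<Rightarrow> trm \<Rightarrow> store \<Rightarrow> trm \<Rightarrow> bool" for n \<tau> where
  run_done: "runs_to n \<tau> w (App (Var 0) \<tau>)"
| run_step: "head_step s s' \<Longrightarrow> runs_to n \<tau> w s' \<Longrightarrow> runs_to n \<tau> w s"
| run_enter: "z \<notin> used w (apps (Var 1) (a # b # us)) \<Longrightarrow>
    runs_to n \<tau> ((z, n, a, b) # w) (apps (Var z) us) \<Longrightarrow>
    runs_to n \<tau> w (apps (Var 1) (a # b # us))"
| run_zero: "(y, 0, a, b) \<in> set w \<Longrightarrow> runs_to n \<tau> w (apps a us) \<Longrightarrow>
    runs_to n \<tau> w (apps (Var y) us)"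
| run_Suc: "(y, Suc k, a, b) \<in> set w \<Longrightarrow> z \<notin> used w (apps (Var y) us) \<Longrightarrow>
    runs_to n \<tau> ((z, k, a, b) # w) (apps (App b (Var z)) us) \<Longrightarrow>
    runs_to n \<tau> w (apps (Var y) us)"

definition realizes_store :: "trm set \<Rightarrow> (nat \<Rightarrow> trm) \<Rightarrow> store \<Rightarrow> bool" where
  "realizes_store R \<sigma> w \<longleftrightarrow>
     (\<forall>(y, k, a, b)\<in>set w. \<sigma> y \<in> iterates R (subst \<sigma> a) (subst \<sigma> b) k)"

text \<open>Freshness keeps \<open>z\<close> out of the stored terms, so its new value disturbs no
  earlier entry.\<close>

lemma realizes_store_Cons:
  assumes w: "realizes_store R \<sigma> w" and z: "z \<notin> used w s" "fv a \<subseteq> used w s" "fv b \<subseteq> used w s"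
    and t: "t \<in> iterates R (subst \<sigma> a) (subst \<sigma> b) k"
  shows "realizes_store R (\<sigma>(z := t)) ((z, k, a, b) # w)"
proof -
  have upd: "subst (\<sigma>(z := t)) u = subst \<sigma> u" if "z \<notin> fv u" for u
    using that by (intro subst_cong) auto
  have "z \<notin> fv a'" "z \<notin> fv b'" "z \<noteq> y" if "(y, k', a', b') \<in> set w" for y k' a' b'
    using z(1) that by (force simp: used_def)+
  moreover have "z \<notin> fv a" "z \<notin> fv b" using z by auto
  ultimately show ?thesis using w t by (fastforce simp: realizes_store_def upd)
qed

text \<open>An actual integer may backtrack: it may return to an earlier stack with a new iterate. This
  repeats the generic run from there with other values for the unknowns, which is why the claim is
  proved for all \<open>\<sigma>\<close>.\<close>

lemma runs_to_simulation:
  assumes "runs_to n \<tau> w s"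
    and R: "R = {s. \<exists>\<sigma>. s \<succ>C App (Var f) (subst \<sigma> \<tau>)}"
    and \<theta>: "\<And>a b. App (App \<theta> a) b \<in> iterates R a b n"
    and "realizes_store R \<sigma> w" "\<sigma> 0 = Var f" "\<sigma> 1 = \<theta>"
  shows "subst \<sigma> s \<in> R"
  using assms(1,4-)
proof (induction arbitrary: \<sigma> rule: runs_to.induct)
  case (run_done w)
  then show ?case by (auto simp: R head_red_def)
next
  case (run_step s s' w)
  then have "head_step (subst \<sigma> s) (subst \<sigma> s')" "subst \<sigma> s' \<in> R"
    by (auto intro: head_step_subst)
  then show ?case unfolding R head_red_def by (auto intro: converse_rtranclp_into_rtranclp)
next
  case (run_enter z w a b us)
  \<comment> \<open>\<open>z\<close> receives the application that it abbreviates, so the terms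
    before and after entering have the same instance.\<close>
  let ?t = "App (App \<theta> (subst \<sigma> a)) (subst \<sigma> b)"
  have z: "z \<noteq> 0" "z \<noteq> 1" "z \<notin> fv (apps (App (App (Var 1) a) b) us)"
    using run_enter(1) by (auto simp: used_def)
  have fv: "fv a \<subseteq> used w (apps (Var 1) (a # b # us))" "fv b \<subseteq> used w (apps (Var 1) (a # b # us))"
    by (auto simp: used_def fv_apps)
  have "realizes_store R (\<sigma>(z := ?t)) ((z, n, a, b) # w)"
    by (rule realizes_store_Cons[OF run_enter(4,1) fv \<theta>])
  then have "subst (\<sigma>(z := ?t)) (apps (Var z) us) \<in> R"
    by (rule run_enter.IH) (use run_enter.prems z in simp_all)
  moreover have "map (subst (\<sigma>(z := ?t))) us = map (subst \<sigma>) us"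
    using z(3) by (auto simp: fv_apps intro!: subst_cong)
  ultimately show ?case using run_enter.prems by (simp add: subst_apps)
next
  case (run_zero y a b w us)
  then have "\<sigma> y \<in> iterates R (subst \<sigma> a) (subst \<sigma> b) 0" by (auto simp: realizes_store_def)
  moreover have "apps (subst \<sigma> a) (map (subst \<sigma>) us) \<in> R"
    using run_zero.IH run_zero.prems by (simp add: subst_apps)
  ultimately show ?case by (simp add: subst_apps iterates_zero)
next
  case (run_Suc y k a b w z us)
  have z: "z \<noteq> 0" "z \<noteq> 1" "z \<notin> fv (apps (Var y) us)" using run_Suc(2) by (auto simp: used_def)
  have fv: "fv a \<subseteq> used w (apps (Var y) us)" "fv b \<subseteq> used w (apps (Var y) us)"
    using run_Suc(1) by (force simp: used_def)+
  have "apps (App (subst \<sigma> b) u) (map (subst \<sigma>) us) \<in> R"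
    if u: "u \<in> iterates R (subst \<sigma> a) (subst \<sigma> b) k" for u
  proof -
    have "realizes_store R (\<sigma>(z := u)) ((z, k, a, b) # w)"
      by (rule realizes_store_Cons[OF run_Suc(5,2) fv u])
    then have "subst (\<sigma>(z := u)) (apps (App b (Var z)) us) \<in> R"
      by (rule run_Suc.IH) (use run_Suc.prems z in simp_all)
    moreover have "map (subst (\<sigma>(z := u))) us = map (subst \<sigma>) us"
      using z(3) by (auto simp: fv_apps intro!: subst_cong)
    moreover have "subst (\<sigma>(z := u)) b = subst \<sigma> b"
      using run_Suc(2) fv by (intro subst_cong) auto
    ultimately show ?thesis by (simp add: subst_apps)
  qed
  moreover have "\<sigma> y \<in> iterates R (subst \<sigma> a) (subst \<sigma> b) (Suc k)"
    using run_Suc.prems(1) run_Suc(1) by (auto simp: realizes_store_def)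
  ultimately show ?case by (simp add: subst_apps iterates_Suc)
qed

section \<open>The realizability model of generic runs\<close>

lemma propositional_wf: "propositional L A \<Longrightarrow> wf_fm L A"
  by (induction A) auto

lemma typ_M_imp_typ_M2: "typ_M L \<Gamma> t A \<Longrightarrow> typ_M2 L E \<Gamma> t A"
  by (induction rule: typ_M.induct) (auto intro: typ_M2.intros propositional_wf)

theorem generic_run:
  fixes L :: "('f, 'p) language"
  assumes T: "closed_trm T" "typ_M L [] T (NC_type \<^bold>\<rightarrow> Neg (Neg N_type))"
  shows "\<exists>m \<tau>. \<tau> \<simeq>\<beta> church m \<and> runs_to n \<tau> [] (App (App T (Var 1)) (Var 0))"
proof -
  define pole where "pole w = {s. \<exists>m \<tau>. \<tau> \<simeq>\<beta> church m \<and> runs_to n \<tau> w s}" for w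
  \<comment> \<open>Worlds are stores, which grow as unknowns are declared; the first-order domain
    is a point, as M has no first-order part.\<close>
  interpret M: realizability_model "\<lambda>w w' :: store. set w \<subseteq> set w'" pole "UNIV :: unit set" "()"
    id "\<lambda>(_::'f) _. ()"
    by unfold_locales (auto simp: pole_def intro: run_step)
  have poleI: "s \<in> pole w"
    if "s' \<in> pole w'" "\<And>\<tau>. runs_to n \<tau> w' s' \<Longrightarrow> runs_to n \<tau> w s" for s s' w w'
    using that by (auto simp: pole_def)
  \<comment> \<open>By induction on the value \<open>k\<close>: \<open>b\<close> is applied to a
    fresh unknown, which the induction hypothesis covers in the extended store.\<close>
  have entry: "Var y \<in> M.orth S w"
    if S: "M.upward S" and "(y, k, a, b) \<in> set w"
      "a \<in> M.orth S w" "b \<in> M.arrow (M.orth S) (M.orth S) w" for S y k a b w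
    using that(2-)
  proof (induction k arbitrary: y w)
    case 0
    have "apps (Var y) us \<in> pole w'" if w': "set w \<subseteq> set w'" "us \<in> S w'" for w' us
    proof -
      have "apps a us \<in> pole w'" using M.orth_apps M.orth_mono[OF 0(2) w'(1)] w'(2) by blast
      moreover have "(y, 0, a, b) \<in> set w'" using 0(1) w'(1) by blast
      ultimately show ?thesis by (rule poleI[OF _ run_zero])
    qed
    then show ?case by (simp add: M.orth_def)
  next
    case (Suc k)
    have "apps (Var y) us \<in> pole w'" if w': "set w \<subseteq> set w'" "us \<in> S w'" for w' us
    proof -
      obtain z where z: "z \<notin> used w' (apps (Var y) us)" using fresh_exists by blast
      let ?w = "(z, k, a, b) # w'"
      have w: "set w \<subseteq> set ?w" "set w' \<subseteq> set ?w" using w' by auto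
      note ab = M.orth_mono[OF Suc.prems(2) w(1)] M.arrow_mono[OF Suc.prems(3) w(1)]
      have "Var z \<in> M.orth S ?w" by (rule Suc.IH[OF _ ab]) simp
      then have "App b (Var z) \<in> M.orth S ?w" using M.arrow_App ab(2) by blast
      moreover have "us \<in> S ?w" using S w(2) w'(2) unfolding M.upward_def by blast
      ultimately have "apps (App b (Var z)) us \<in> pole ?w" by (rule M.orth_apps)
      moreover have "(y, Suc k, a, b) \<in> set w'" using Suc.prems(1) w'(1) by blast
      ultimately show ?thesis using run_Suc[OF _ z] poleI by blast
    qed
    then show ?case by (simp add: M.orth_def)
  qed
  let ?\<rho> = "\<lambda>_::nat. ()" and ?\<eta> = "\<lambda>(_::kind) (_::nat) (_::nat) (_::unit list). M.orth (\<lambda>_. {})"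
  have "M.candidate \<kappa> (M.orth (\<lambda>_. {}))" for \<kappa>
    by (cases \<kappa>) (auto simp: M.candidate_def M.saturated_orth M.upward_def)
  then have \<eta>: "M.adm_env ?\<eta>" by (simp add: M.adm_env_def)
  have "subst Var T \<in> M.sem ?\<rho> ?\<eta> (NC_type \<^bold>\<rightarrow> Neg (Neg N_type) :: ('f, 'p) fm) []"
    by (rule M.soundness[OF typ_M_imp_typ_M2[OF T(2), of "{}"]]) (use \<eta> in auto)
  then have T': "T \<in> M.sem ?\<rho> ?\<eta> (NC_type \<^bold>\<rightarrow> Neg (Neg N_type) :: ('f, 'p) fm) []"
    by (simp add: subst_Var)
  \<comment> \<open>The generic integer realizes \<open>NC_type\<close>: \<open>run_enter\<close>
    leads to a store in which \<open>entry\<close> covers the new unknown.\<close>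
  have "Var 1 \<in> M.arrow v (M.arrow (M.arrow v v) v) w" if v: "M.candidate Cls v" for v w
  proof -
    obtain S where S: "M.upward S" "v = M.orth S" using v by (auto simp: M.candidate_def)
    have "apps (App (App (Var 1) a) b) us \<in> pole w3"
      if w: "set w1 \<subseteq> set w2" "set w2 \<subseteq> set w3" and a: "a \<in> v w1" and b: "b \<in> M.arrow v v w2"
        and us: "us \<in> S w3" for a b us w1 w2 w3
    proof -
      obtain z where z: "z \<notin> used w3 (apps (Var 1) (a # b # us))" using fresh_exists by blast
      let ?w = "(z, n, a, b) # w3"
      have w': "set w1 \<subseteq> set ?w" "set w2 \<subseteq> set ?w" using w by auto
      have "Var z \<in> M.orth S ?w"
        using entry[OF S(1), of z n a b ?w] M.orth_mono[OF _ w'(1)] M.arrow_mono[OF _ w'(2)] a b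
        by (simp add: S(2))
      moreover have "us \<in> S ?w"
        using S(1) us unfolding M.upward_def by (meson set_subset_Cons subsetD)
      ultimately have "apps (Var z) us \<in> pole ?w" by (rule M.orth_apps)
      then show ?thesis using run_enter[OF z] by (simp add: poleI)
    qed
    then have "App (App (Var 1) a) b \<in> v w2"
      if "set w1 \<subseteq> set w2" "a \<in> v w1" "b \<in> M.arrow v v w2" for a b w1 w2
      using that unfolding S(2) M.orth_def[of S w2] by blast
    then show ?thesis unfolding M.arrow_def[of v "M.arrow (M.arrow v v) v"]
        M.arrow_def[of "M.arrow v v" v] by blast
  qed
  then have \<nu>: "Var 1 \<in> M.sem ?\<rho> ?\<eta> (NC_type :: ('f, 'p) fm) []"
    by (simp add: NC_type_def ins_var_def)
  \<comment> \<open>An ordinary variable may take any saturated value, even one unrelated to the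
    pole. Numeral bodies over fresh \<open>x\<close> and \<open>f\<close> reveal the Church
    integer.\<close>
  have church: "\<exists>m. u \<simeq>\<beta> church m" if u: "u \<in> M.sem ?\<rho> ?\<eta> (N_type :: ('f, 'p) fm) w" for u w
  proof -
    obtain x where x: "x \<notin> fv u" using ex_new_if_finite[OF infinite_UNIV_nat finite_fv] by blast
    obtain f where f: "f \<notin> insert x (fv u)"
      using ex_new_if_finite[OF infinite_UNIV_nat, of "insert x (fv u)"] finite_fv by blast
    let ?v = "\<lambda>w::store. {t. numeral_body x f t}"
    have "M.saturated ?v" by (auto simp: M.saturated_def M.upward_def intro: nb_step)
    then have "u \<in> M.sem ?\<rho> (ins_var Ord 0 0 (\<lambda>_. ?v) ?\<eta>)
        (PVar Ord 0 [] \<^bold>\<rightarrow> (PVar Ord 0 [] \<^bold>\<rightarrow> PVar Ord 0 []) \<^bold>\<rightarrow> PVar Ord 0 [] :: ('f, 'p) fm) w"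
      using u by (simp add: N_type_def M.candidate_def del: M.sem.simps(1-4))
    then have "u \<in> M.arrow ?v (M.arrow (M.arrow ?v ?v) ?v) w" by (simp add: ins_var_def)
    moreover have "Var x \<in> ?v w" by (simp add: nb_zero)
    ultimately have "App u (Var x) \<in> M.arrow (M.arrow ?v ?v) ?v w" by (auto simp: M.arrow_def)
    moreover have "Var f \<in> M.arrow ?v ?v w" by (simp add: M.arrow_def nb_Suc)
    ultimately have "App (App u (Var x)) (Var f) \<in> ?v w" by (auto simp: M.arrow_def)
    then show ?thesis using x f church_if_numeral_body[of x f u] by auto
  qed
  \<comment> \<open>By \<open>church\<close>, \<open>(f)u\<close> is already a finished run, at
    every world.\<close>
  have "App (Var 0) u \<in> pole w" if "u \<in> M.sem ?\<rho> ?\<eta> (N_type :: ('f, 'p) fm) w" for u w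
    using church[OF that] run_done unfolding pole_def by blast
  then have f: "Var 0 \<in> M.sem ?\<rho> ?\<eta> (Neg N_type :: ('f, 'p) fm) []"
    using M.saturated_sem[OF \<eta>, of ?\<rho> "N_type :: ('f, 'p) fm"]
    unfolding M.saturated_def M.upward_def by (simp add: M.arrow_def M.orth_def) blast
  have "T \<in> M.arrow (M.sem ?\<rho> ?\<eta> (NC_type :: ('f, 'p) fm))
      (M.arrow (M.sem ?\<rho> ?\<eta> (Neg N_type :: ('f, 'p) fm)) (M.orth (\<lambda>_. {[]}))) []"
    using T' by simp
  from M.arrow_App[OF M.arrow_App[OF this \<nu>] f] have "App (App T (Var 1)) (Var 0) \<in> pole []"
    using M.orth_apps[of _ "\<lambda>_. {[]}" "[]" "[]"] by simp
  then show ?thesis by (auto simp: pole_def)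
qed

theorem theorem6p4:
  fixes L :: "('f, 'p) language" and E :: "('f tm \<times> 'f tm) set" and T :: trm
  assumes "equations_over L E"
    and "adequate L E"
    and "closed_trm T"
    and "typ_M L [] T (NC_type \<^bold>\<rightarrow> Neg (Neg N_type))"
  shows "\<forall>n. \<exists>m \<tau>. \<tau> \<simeq>\<beta> church m \<and>
           (\<forall>\<theta>. classical_integer L E n \<theta> \<longrightarrow>
             (\<forall>f. \<exists>\<sigma>. App (App T \<theta>) (Var f) \<succ>C App (Var f) (subst \<sigma> \<tau>)))"
proof
  fix n
  \<comment> \<open>\<open>m\<close> and \<open>\<tau>\<close> are fixed before \<theta> and
    \<open>f\<close> are chosen; this is the uniformity claimed.\<close>
  obtain m \<tau> where \<tau>: "\<tau> \<simeq>\<beta> church m" "runs_to n \<tau> [] (App (App T (Var 1)) (Var 0))"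
    using generic_run[OF assms(3,4)] by blast
  have "\<exists>\<sigma>. App (App T \<theta>) (Var f) \<succ>C App (Var f) (subst \<sigma> \<tau>)"
    if \<theta>: "classical_integer L E n \<theta>" for \<theta> f
  proof -
    define R where "R = {s. \<exists>\<sigma>. s \<succ>C App (Var f) (subst \<sigma> \<tau>)}"
    have R: "s \<in> R" if "head_step s s'" "s' \<in> R" for s s'
      using that unfolding R_def head_red_def by (auto intro: converse_rtranclp_into_rtranclp)
    have it: "App (App \<theta> a) b \<in> iterates R a b n" for a b
      unfolding iterates_def
    proof (intro CollectI allI impI)
      fix Y assume Y: "orth_closed R a b Y"
      show "\<forall>us\<in>Y n. apps (App (App \<theta> a) b) us \<in> R"
        by (rule classical_integer_induction[OF assms(1,2) \<theta>])
          (use R Y in \<open>unfold orth_closed_def, meson+\<close>)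
    qed
    \<comment> \<open>\<open>T\<close> is closed, so only indices 0 and 1 matter; the initial store
      is empty and hence realized.\<close>
    let ?\<sigma> = "\<lambda>i. if i = 0 then Var f else \<theta>"
    have "subst ?\<sigma> (App (App T (Var 1)) (Var 0)) \<in> R"
      by (rule runs_to_simulation[OF \<tau>(2) R_def it]) (auto simp: realizes_store_def)
    then show ?thesis using assms(3) by (simp add: R_def subst_closed)
  qed
  with \<tau>(1) show "\<exists>m \<tau>. \<tau> \<simeq>\<beta> church m \<and>
           (\<forall>\<theta>. classical_integer L E n \<theta> \<longrightarrow>
             (\<forall>f. \<exists>\<sigma>. App (App T \<theta>) (Var f) \<succ>C App (Var f) (subst \<sigma> \<tau>)))"
    by blast
qed

end
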